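(* Let $\mathcal H$ be a finite graph and $\Delta$ a positive integer. (1) If there is an $r$-round GLOCAL algorithm that $\Delta$-colors $\mathrm{Hom}(T^{r+1}_\Delta,\mathcal H^{ID})$, then $\mathcal H$ has an $r$-round $\Delta$-coloring in the LOCAL model. (2) Assume $\mathcal H$ is equipped with a nice edge $\Delta$-labeling. If there is an $r$-round GLOCAL algorithm producing an edge labeled $\Delta$-coloring of every element of $\mathrm{Hom}^e(T^{r+1}_\Delta,\mathcal H^{ID})$, then $\mathcal H$ has an $r$-round edge labeled $\Delta$-coloring in the LOCAL model.
   Context: An ID assignment on $\mathcal H$ is an injective map $\mathrm{id}:V(\mathcal H)\to\{0,1,\dots,|V(\mathcal H)|-1\}$. $T_\Delta$ is the infinite $\Delta$-regular tree, $T'_\Delta$ is $T_\Delta$ equipped with a proper edge coloring with colors $\{1,\dots,\Delta\}$, and $T^r_\Delta$ is the ball of radius $r$ around a vertex (in the edge-labeled setting, with the inherited edge coloring). $\mathrm{Hom}(T^r_\Delta,\mathcal H^{ID})$ is the set of labelings of $T^r_\Delta$ of the form $\mathrm{id}\circ\varphi$, where $\mathrm{id}$ is an ID assignment on $\mathcal H$ and $\varphi:T^r_\Delta\to\mathcal H$ is a graph homomorphism. An edge $\Delta$-labeling of $\mathcal H$ is a map $E(\mathcal H)\to\{1,\dots,\Delta\}$; it is nice if every vertex is incident to edges of every label. $\mathrm{Hom}^e(T^r_\Delta,\mathcal H^{ID})$ is defined likewise with $\varphi$ required to be an edge-label preserving homomorphism from the edge-colored $T^r_\Delta$. For a graph with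 edge $\Delta$-labeling $e$, an edge labeled $\Delta$-coloring is $c:V\to\{1,\dots,\Delta\}$ with no adjacent $v,w$ satisfying $c(v)=c(w)=e(v,w)$. An $r$-round GLOCAL algorithm (on trees with degrees $\le\Delta$) is a partial function from isomorphism classes of labeled rooted trees (including edge colors when present) of maximum degree $\le\Delta$ and radius $\le r$ to a set $\Sigma$; running it on a labeled tree $G$ gives each vertex $v$ its value on the labeled ball $B_G(v,r)$ rooted at $v$; it $\Delta$-colors a collection if on each member every vertex gets one of $\Delta$ colors forming a proper vertex coloring. "$\mathcal H$ has an $r$-round ($\Delta$-coloring, resp. edge labeled $\Delta$-coloring) in the LOCAL model" means there is a rule assigning to each vertex $v$ an output depending only on the ball $B_{\mathcal H}(v,r)$ together with the restriction of $\mathrm{id}$ (and edge labels) to it, such that for every ID assignment $\mathrm{id}$ on $\mathcal H$ the outputs form a proper vertex coloring with $\Delta$ colors (resp. an edge labeled $\Delta$-coloring) of $\mathcal H$. *)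

theory Defs
  imports Main "HOL-Library.FuncSet"
begin

record 'v ugraph =
  verts :: "'v set"
  edges :: "'v set set"

definition simple_graph :: "('v, 'm) ugraph_scheme \<Rightarrow> bool" where
  "simple_graph G \<longleftrightarrow> (\<forall>e\<in>edges G. e \<subseteq> verts G \<and> card e = 2)"

definition arcs :: "('v, 'm) ugraph_scheme \<Rightarrow> 'v rel" where
  "arcs G = {(u, v). {u, v} \<in> edges G}"

definition degree :: "('v, 'm) ugraph_scheme \<Rightarrow> 'v \<Rightarrow> nat" where
  "degree G v = card {e \<in> edges G. v \<in> e}"

definition ball_verts :: "('v, 'm) ugraph_scheme \<Rightarrow> 'v \<Rightarrow> nat \<Rightarrow> 'v set" where
  "ball_verts G v r = {w \<in> verts G. \<exists>k\<le>r. (v, w) \<in> arcs G ^^ k}"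

definition induced :: "('v, 'm) ugraph_scheme \<Rightarrow> 'v set \<Rightarrow> 'v ugraph" where
  "induced G U = \<lparr>verts = verts G \<inter> U, edges = {e \<in> edges G. e \<subseteq> U}\<rparr>"

definition gball :: "('v, 'm) ugraph_scheme \<Rightarrow> 'v \<Rightarrow> nat \<Rightarrow> 'v ugraph" where
  "gball G v r = induced G (ball_verts G v r)"

definition connected_graph :: "('v, 'm) ugraph_scheme \<Rightarrow> bool" where
  "connected_graph G \<longleftrightarrow> (\<forall>u\<in>verts G. \<forall>v\<in>verts G. (u, v) \<in> (arcs G)\<^sup>*)"

definition is_cycle :: "('v, 'm) ugraph_scheme \<Rightarrow> 'v list \<Rightarrow> bool" where
  "is_cycle G xs \<longleftrightarrow> length xs \<ge> 3 \<and> distinct xs \<and>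
     (\<forall>i<length xs. {xs ! i, xs ! (Suc i mod length xs)} \<in> edges G)"

definition is_tree :: "('v, 'm) ugraph_scheme \<Rightarrow> bool" where
  "is_tree G \<longleftrightarrow> simple_graph G \<and> verts G \<noteq> {} \<and> connected_graph G \<and> (\<nexists>xs. is_cycle G xs)"

text \<open>Graphs without edge labels are treated as graphs with edge labels of type \<^typ>\<open>unit\<close>.\<close>

record ('v, 'l, 'e) lrgraph = "'v ugraph" +
  vlab :: "'v \<Rightarrow> 'l"
  elab :: "'v set \<Rightarrow> 'e"
  base :: "'v"

definition lr_iso :: "('v, 'l, 'e) lrgraph \<Rightarrow> ('w, 'l, 'e) lrgraph \<Rightarrow> bool" where
  "lr_iso G K \<longleftrightarrow> (\<exists>f. bij_betw f (verts G) (verts K) \<and> (`) f ` edges G = edges K \<and>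
     (\<forall>v\<in>verts G. vlab K (f v) = vlab G v) \<and>
     (\<forall>e\<in>edges G. elab K (f ` e) = elab G e) \<and>
     f (base G) = base K)"

text \<open>Every finite graph has an isomorphic copy on natural numbers, so the isomorphism class of a
  finite graph over any vertex type is represented by the set of these copies; see
  \<open>iso_class_eq_iff\<close> below.\<close>

definition iso_class :: "('v, 'l, 'e) lrgraph \<Rightarrow> (nat, 'l, 'e) lrgraph set" where
  "iso_class G = {K. lr_iso G K}"

text \<open>The data of a node's neighborhood is the subgraph induced on the vertices at distance at most
  \<open>r\<close>; values of the label functions outside it are ignored by \<^const>\<open>lr_iso\<close>.\<close>

definition view ::
  "'v ugraph \<Rightarrow> ('v \<Rightarrow> 'l) \<Rightarrow> ('v set \<Rightarrow> 'e) \<Rightarrow> nat \<Rightarrow> 'v \<Rightarrow> ('v, 'l, 'e) lrgraph" where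
  "view G lab el r v = \<lparr>verts = verts (gball G v r), edges = edges (gball G v r),
     vlab = lab, elab = el, base = v\<rparr>"

text \<open>The tree is the Cayley graph of the free product of \<open>\<Delta>\<close> copies of the group of order two:
  vertices are the reduced words over \<open>{1..\<Delta>}\<close>, and the edge joining \<open>w\<close> and \<open>i # w\<close> has
  color \<open>i\<close>. For \<open>\<Delta> = 1\<close> it is a single edge.\<close>

definition reg_tree :: "nat \<Rightarrow> nat list ugraph" where
  "reg_tree \<Delta> = (let W = {w. set w \<subseteq> {1..\<Delta>} \<and> distinct_adj w}
     in \<lparr>verts = W, edges = {{w, i # w} | i w. i # w \<in> W}\<rparr>)"

definition tree_color :: "nat list set \<Rightarrow> nat" where
  "tree_color e = (THE i. \<exists>w. e = {w, i # w})"

definition tree_ball :: "nat \<Rightarrow> nat \<Rightarrow> nat list ugraph" where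
  "tree_ball \<Delta> r = gball (reg_tree \<Delta>) [] r"

definition id_assignment :: "'v ugraph \<Rightarrow> ('v \<Rightarrow> nat) \<Rightarrow> bool" where
  "id_assignment H ident \<longleftrightarrow> inj_on ident (verts H) \<and> ident \<in> verts H \<rightarrow> {..<card (verts H)}"

definition graph_hom :: "'t ugraph \<Rightarrow> 'v ugraph \<Rightarrow> ('t \<Rightarrow> 'v) \<Rightarrow> bool" where
  "graph_hom T H \<phi> \<longleftrightarrow> \<phi> \<in> verts T \<rightarrow> verts H \<and> (\<forall>e\<in>edges T. \<phi> ` e \<in> edges H)"

definition edge_graph_hom ::
  "'t ugraph \<Rightarrow> ('t set \<Rightarrow> nat) \<Rightarrow> 'v ugraph \<Rightarrow> ('v set \<Rightarrow> nat) \<Rightarrow> ('t \<Rightarrow> 'v) \<Rightarrow> bool" where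
  "edge_graph_hom T tc H el \<phi> \<longleftrightarrow> graph_hom T H \<phi> \<and> (\<forall>e\<in>edges T. el (\<phi> ` e) = tc e)"

definition Hom_ID :: "'t ugraph \<Rightarrow> 'v ugraph \<Rightarrow> ('t \<Rightarrow> nat) set" where
  "Hom_ID T H = {ident \<circ> \<phi> | ident \<phi>. id_assignment H ident \<and> graph_hom T H \<phi>}"

definition edge_Hom_ID ::
  "'t ugraph \<Rightarrow> ('t set \<Rightarrow> nat) \<Rightarrow> 'v ugraph \<Rightarrow> ('v set \<Rightarrow> nat) \<Rightarrow> ('t \<Rightarrow> nat) set" where
  "edge_Hom_ID T tc H el =
     {ident \<circ> \<phi> | ident \<phi>. id_assignment H ident \<and> edge_graph_hom T tc H el \<phi>}"

definition edge_labeling :: "nat \<Rightarrow> 'v ugraph \<Rightarrow> ('v set \<Rightarrow> nat) \<Rightarrow> bool" where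
  "edge_labeling \<Delta> H el \<longleftrightarrow> el \<in> edges H \<rightarrow> {1..\<Delta>}"

definition nice_labeling :: "nat \<Rightarrow> 'v ugraph \<Rightarrow> ('v set \<Rightarrow> nat) \<Rightarrow> bool" where
  "nice_labeling \<Delta> H el \<longleftrightarrow> edge_labeling \<Delta> H el \<and>
     (\<forall>v\<in>verts H. \<forall>i\<in>{1..\<Delta>}. \<exists>e\<in>edges H. v \<in> e \<and> el e = i)"

definition vertex_coloring :: "nat \<Rightarrow> 'v ugraph \<Rightarrow> ('v \<Rightarrow> nat) \<Rightarrow> bool" where
  "vertex_coloring \<Delta> G c \<longleftrightarrow> c \<in> verts G \<rightarrow> {1..\<Delta>} \<and>
     (\<forall>v w. {v, w} \<in> edges G \<longrightarrow> c v \<noteq> c w)"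

definition edge_labeled_coloring ::
  "nat \<Rightarrow> 'v ugraph \<Rightarrow> ('v set \<Rightarrow> nat) \<Rightarrow> ('v \<Rightarrow> nat) \<Rightarrow> bool" where
  "edge_labeled_coloring \<Delta> G el c \<longleftrightarrow> c \<in> verts G \<rightarrow> {1..\<Delta>} \<and>
     (\<forall>v w. {v, w} \<in> edges G \<longrightarrow> \<not> (c v = c w \<and> c w = el {v, w}))"

definition glocal_inputs :: "nat \<Rightarrow> nat \<Rightarrow> (nat, 'l, 'e) lrgraph set" where
  "glocal_inputs \<Delta> r = {K. is_tree K \<and> finite (verts K) \<and> base K \<in> verts K \<and>
     (\<forall>v\<in>verts K. degree K v \<le> \<Delta>) \<and> ball_verts K (base K) r = verts K}"

definition glocal_algorithm ::
  "nat \<Rightarrow> nat \<Rightarrow> ((nat, 'l, 'e) lrgraph set \<rightharpoonup> 's) \<Rightarrow> bool" where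
  "glocal_algorithm \<Delta> r A \<longleftrightarrow> dom A \<subseteq> iso_class ` glocal_inputs \<Delta> r"

definition run :: "((nat, 'l, 'e) lrgraph set \<Rightarrow> 's) \<Rightarrow> nat \<Rightarrow>
    'v ugraph \<Rightarrow> ('v \<Rightarrow> 'l) \<Rightarrow> ('v set \<Rightarrow> 'e) \<Rightarrow> 'v \<Rightarrow> 's" where
  "run A r G lab el v = A (iso_class (view G lab el r v))"

definition glocal_colors :: "nat \<Rightarrow> nat \<Rightarrow> ((nat, nat, unit) lrgraph set \<rightharpoonup> nat) \<Rightarrow>
    'v ugraph \<Rightarrow> ('v \<Rightarrow> nat) set \<Rightarrow> bool" where
  "glocal_colors \<Delta> r A G L \<longleftrightarrow> (\<forall>lab\<in>L. \<exists>c.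
     (\<forall>v\<in>verts G. run A r G lab (\<lambda>_. ()) v = Some (c v)) \<and> vertex_coloring \<Delta> G c)"

definition glocal_edge_colors :: "nat \<Rightarrow> nat \<Rightarrow> ((nat, nat, nat) lrgraph set \<rightharpoonup> nat) \<Rightarrow>
    'v ugraph \<Rightarrow> ('v set \<Rightarrow> nat) \<Rightarrow> ('v \<Rightarrow> nat) set \<Rightarrow> bool" where
  "glocal_edge_colors \<Delta> r A G el L \<longleftrightarrow> (\<forall>lab\<in>L. \<exists>c.
     (\<forall>v\<in>verts G. run A r G lab el v = Some (c v)) \<and> edge_labeled_coloring \<Delta> G el c)"

definition local_coloring :: "nat \<Rightarrow> nat \<Rightarrow> 'v ugraph \<Rightarrow> bool" where
  "local_coloring \<Delta> r H \<longleftrightarrow> (\<exists>f :: (nat, nat, unit) lrgraph set \<Rightarrow> nat.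
     \<forall>ident. id_assignment H ident \<longrightarrow> vertex_coloring \<Delta> H (run f r H ident (\<lambda>_. ())))"

definition local_edge_coloring :: "nat \<Rightarrow> nat \<Rightarrow> 'v ugraph \<Rightarrow> ('v set \<Rightarrow> nat) \<Rightarrow> bool" where
  "local_edge_coloring \<Delta> r H el \<longleftrightarrow> (\<exists>f :: (nat, nat, nat) lrgraph set \<Rightarrow> nat.
     \<forall>ident. id_assignment H ident \<longrightarrow> edge_labeled_coloring \<Delta> H el (run f r H ident el))"

lemma tree_color_edge [simp]: "tree_color {w, i # w} = i"
  unfolding tree_color_def by (rule the_equality) (auto simp: doubleton_eq_iff)

lemma simple_reg_tree: "simple_graph (reg_tree \<Delta>)"
proof -
  have "distinct_adj w" if "distinct_adj (i # w)" for i and w :: "nat list"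
    using that by (cases w) auto
  then show ?thesis
    unfolding simple_graph_def reg_tree_def Let_def by auto
qed

lemma reg_tree_edgeI: "i # w \<in> verts (reg_tree \<Delta>) \<Longrightarrow> {w, i # w} \<in> edges (reg_tree \<Delta>)"
  unfolding reg_tree_def Let_def by auto

lemma reg_tree_arcD:
  assumes "{u, v} \<in> edges (reg_tree \<Delta>)"
  shows "(\<exists>i. u = i # v) \<or> (\<exists>i. v = i # u)"
  using assms unfolding reg_tree_def Let_def by (auto simp: doubleton_eq_iff)

lemma degree_reg_tree:
  assumes "w \<in> verts (reg_tree \<Delta>)"
  shows "degree (reg_tree \<Delta>) w = \<Delta>"
    and "bij_betw tree_color {e \<in> edges (reg_tree \<Delta>). w \<in> e} {1..\<Delta>}"
proof -
  let ?E = "{e \<in> edges (reg_tree \<Delta>). w \<in> e}"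
  have w: "set w \<subseteq> {1..\<Delta>}" "distinct_adj w"
    using assms by (auto simp: reg_tree_def)
  have E: "e \<in> ?E \<longleftrightarrow> (\<exists>i. i \<in> {1..\<Delta>} \<and> e = (if w \<noteq> [] \<and> hd w = i then {tl w, w} else {w, i # w}))"
    for e
  proof
    assume "e \<in> ?E"
    then obtain i u where e: "e = {u, i # u}" "set (i # u) \<subseteq> {1..\<Delta>}" "distinct_adj (i # u)" "w \<in> e"
      unfolding reg_tree_def Let_def by auto
    then consider "w = u" | "w = i # u" by auto
    then show "\<exists>i. i \<in> {1..\<Delta>} \<and> e = (if w \<noteq> [] \<and> hd w = i then {tl w, w} else {w, i # w})"
    proof cases
      case 1
      then show ?thesis using e by (intro exI[of _ i]) (auto simp: distinct_adj_Cons)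
    next
      case 2
      then show ?thesis using e by (intro exI[of _ i]) auto
    qed
  next
    assume "\<exists>i. i \<in> {1..\<Delta>} \<and> e = (if w \<noteq> [] \<and> hd w = i then {tl w, w} else {w, i # w})"
    then obtain i where i: "i \<in> {1..\<Delta>}"
      "e = (if w \<noteq> [] \<and> hd w = i then {tl w, w} else {w, i # w})" by blast
    show "e \<in> ?E"
    proof (cases "w \<noteq> [] \<and> hd w = i")
      case True
      then have "e = {tl w, w}" "hd w # tl w = w" using i by auto
      then show ?thesis using reg_tree_edgeI[of "hd w" "tl w" \<Delta>] assms by auto
    next
      case False
      then have "e = {w, i # w}" "i # w \<in> verts (reg_tree \<Delta>)"
        using i w by (auto simp: reg_tree_def distinct_adj_Cons)
      then show ?thesis using reg_tree_edgeI[of i w \<Delta>] by auto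
    qed
  qed
  define g where "g i = (if w \<noteq> [] \<and> hd w = i then {tl w, w} else {w, i # w})" for i
  have col: "tree_color (g i) = i" for i
  proof (cases "w \<noteq> [] \<and> hd w = i")
    case True
    then have "g i = {tl w, i # tl w}" by (auto simp: g_def)
    then show ?thesis by simp
  qed (auto simp: g_def)
  have "?E = g ` {1..\<Delta>}" using E unfolding g_def by blast
  then show b: "bij_betw tree_color ?E {1..\<Delta>}"
    by (auto simp: bij_betw_def inj_on_def col image_image)
  show "degree (reg_tree \<Delta>) w = \<Delta>"
    using bij_betw_same_card[OF b] by (simp add: degree_def)
qed

lemma is_tree_reg_tree: "is_tree (reg_tree \<Delta>)"
proof -
  let ?T = "reg_tree \<Delta>"
  have sym: "sym (arcs ?T)" by (auto simp: sym_def arcs_def insert_commute)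
  have root: "w \<in> verts ?T \<Longrightarrow> (w, []) \<in> (arcs ?T)\<^sup>*" for w
  proof (induction w)
    case (Cons i w)
    then have "w \<in> verts ?T" "(i # w, w) \<in> arcs ?T"
      by (auto simp: reg_tree_def arcs_def distinct_adj_Cons insert_commute)
    then show ?case using Cons.IH by (meson converse_rtrancl_into_rtrancl)
  qed auto
  have "connected_graph ?T"
    unfolding connected_graph_def
  proof (intro ballI)
    fix u v assume "u \<in> verts ?T" "v \<in> verts ?T"
    moreover from this have "([], v) \<in> (arcs ?T)\<^sup>*" using root symD[OF sym_rtrancl[OF sym]] by blast
    ultimately show "(u, v) \<in> (arcs ?T)\<^sup>*" using root by (meson rtrancl_trans)
  qed
  moreover have False if "is_cycle ?T xs" for xs
  proof -
    let ?n = "length xs"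
    have n: "?n \<ge> 3" "distinct xs" and
      ed: "\<And>i. i < ?n \<Longrightarrow> {xs ! i, xs ! (Suc i mod ?n)} \<in> edges ?T"
      using that by (auto simp: is_cycle_def)
    define m where "m = Max (length ` set xs)"
    have "m \<in> length ` set xs" unfolding m_def using n by (intro Max_in) auto
    then obtain k where k: "k < ?n" "length (xs ! k) = m" by (auto simp: in_set_conv_nth)
    have le: "length (xs ! j) \<le> m" if "j < ?n" for j
      unfolding m_def using that by (intro Max_ge) auto
    define s where "s = (if Suc k = ?n then 0 else Suc k)"
    define p where "p = (if k = 0 then ?n - 1 else k - 1)"
    have sp: "s < ?n" "p < ?n" "s \<noteq> p" "Suc k mod ?n = s" "Suc p mod ?n = k"
      using n(1) k(1) unfolding s_def p_def by (auto split: if_splits)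
    have "{xs ! k, xs ! s} \<in> edges ?T" "{xs ! p, xs ! k} \<in> edges ?T"
      using ed[OF k(1)] ed[OF sp(2)] sp(4,5) by simp_all
    then have "(\<exists>i. xs ! k = i # xs ! s)" "(\<exists>i. xs ! k = i # xs ! p)"
      using reg_tree_arcD[of "xs ! k" "xs ! s" \<Delta>] reg_tree_arcD[of "xs ! p" "xs ! k" \<Delta>]
        le[OF sp(1)] le[OF sp(2)] k(2) by auto
    then have "xs ! s = xs ! p" by auto
    then show False using n(2) sp by (simp add: nth_eq_iff_index_eq)
  qed
  moreover have "[] \<in> verts ?T" by (simp add: reg_tree_def)
  ultimately show ?thesis unfolding is_tree_def using simple_reg_tree by blast
qed

lemma lr_iso_refl: "lr_iso G G"
  unfolding lr_iso_def by (intro exI[of _ id]) auto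

lemma lr_iso_trans:
  assumes "lr_iso G K" "lr_iso K L"
  shows "lr_iso G L"
proof -
  obtain f where f: "bij_betw f (verts G) (verts K)" "(`) f ` edges G = edges K"
    "\<forall>v\<in>verts G. vlab K (f v) = vlab G v" "\<forall>e\<in>edges G. elab K (f ` e) = elab G e"
    "f (base G) = base K" using assms(1) unfolding lr_iso_def by blast
  obtain g where g: "bij_betw g (verts K) (verts L)" "(`) g ` edges K = edges L"
    "\<forall>v\<in>verts K. vlab L (g v) = vlab K v" "\<forall>e\<in>edges K. elab L (g ` e) = elab K e"
    "g (base K) = base L" using assms(2) unfolding lr_iso_def by blast
  have "bij_betw (g \<circ> f) (verts G) (verts L)" using f(1) g(1) by (rule bij_betw_trans)
  moreover have "(`) (g \<circ> f) ` edges G = edges L"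
    unfolding g(2)[symmetric] f(2)[symmetric] by (simp add: image_image)
  moreover have "\<forall>v\<in>verts G. vlab L ((g \<circ> f) v) = vlab G v"
    using f(3) g(3) bij_betwE[OF f(1)] by simp
  moreover have "\<forall>e\<in>edges G. elab L ((g \<circ> f) ` e) = elab G e"
  proof
    fix e assume e: "e \<in> edges G"
    then have "f ` e \<in> edges K" using f(2) by blast
    then show "elab L ((g \<circ> f) ` e) = elab G e"
      using e f(4) g(4) by (simp add: image_image[symmetric])
  qed
  ultimately show ?thesis using f(5) g(5) unfolding lr_iso_def by (intro exI[of _ "g \<circ> f"]) auto
qed

lemma lr_iso_sym:
  assumes "lr_iso G K" and G: "\<forall>e\<in>edges G. e \<subseteq> verts G" and b: "base G \<in> verts G"
  shows "lr_iso K G"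
proof -
  obtain f where f: "bij_betw f (verts G) (verts K)" "(`) f ` edges G = edges K"
    "\<forall>v\<in>verts G. vlab K (f v) = vlab G v" "\<forall>e\<in>edges G. elab K (f ` e) = elab G e"
    "f (base G) = base K" using assms(1) unfolding lr_iso_def by blast
  define g where "g = inv_into (verts G) f"
  have gf: "g (f v) = v" if "v \<in> verts G" for v
    using that f(1) unfolding g_def bij_betw_def by (blast intro: inv_into_f_f)
  have gfe: "g ` f ` e = e" if "e \<in> edges G" for e
  proof -
    have "g ` f ` e = (\<lambda>v. v) ` e"
      unfolding image_image using G that gf by (intro image_cong) auto
    then show ?thesis by simp
  qed
  show ?thesis
    unfolding lr_iso_def
  proof (intro exI[of _ g] conjI ballI)
    show "bij_betw g (verts K) (verts G)" unfolding g_def by (rule bij_betw_inv_into[OF f(1)])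
    show "(`) g ` edges K = edges G"
      unfolding f(2)[symmetric] by (simp add: image_image[of "(`) g"] gfe)
    show "vlab G (g v) = vlab K v" if "v \<in> verts K" for v
    proof -
      have "v \<in> f ` verts G" using that bij_betw_imp_surj_on[OF f(1)] by simp
      then obtain u where "u \<in> verts G" "v = f u" by (rule imageE)
      then show ?thesis using f(3) gf by simp
    qed
    show "elab G (g ` e) = elab K e" if "e \<in> edges K" for e
    proof -
      have "e \<in> (`) f ` edges G" using that f(2) by simp
      then obtain d where "d \<in> edges G" "e = f ` d" by (rule imageE)
      then show ?thesis using f(4) gfe by simp
    qed
    show "g (base K) = base G" using f(5) gf[OF b] by simp
  qed
qed

lemma iso_class_eq_iff:
  fixes G :: "('v, 'l, 'e) lrgraph" and K :: "('w, 'l, 'e) lrgraph"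
  assumes G: "finite (verts G)" "\<forall>e\<in>edges G. e \<subseteq> verts G" "base G \<in> verts G"
    and K: "\<forall>e\<in>edges K. e \<subseteq> verts K" "base K \<in> verts K"
  shows "iso_class G = iso_class K \<longleftrightarrow> lr_iso G K"
proof
  obtain f :: "'v \<Rightarrow> nat" where f: "inj_on f (verts G)"
    using finite_imp_inj_to_nat_seg[OF G(1)] by blast
  define N where "N = \<lparr>verts = f ` verts G, edges = (`) f ` edges G,
    vlab = vlab G \<circ> inv_into (verts G) f, elab = elab G \<circ> (`) (inv_into (verts G) f),
    base = f (base G)\<rparr>"
  have inv: "inv_into (verts G) f ` f ` e = e" if "e \<in> edges G" for e
    using inv_into_image_cancel[OF f] G(2) that by blast
  have GN: "lr_iso G N"
    unfolding lr_iso_def N_def using f inv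
    by (intro exI[of _ f]) (auto simp: bij_betw_def)
  assume "iso_class G = iso_class K"
  then have "lr_iso K N" using GN by (auto simp: iso_class_def)
  then show "lr_iso G K" by (rule lr_iso_trans[OF GN lr_iso_sym[OF _ K]])
next
  assume GK: "lr_iso G K"
  have KG: "lr_iso K G" by (rule lr_iso_sym[OF GK G(2,3)])
  show "iso_class G = iso_class K"
    unfolding iso_class_def using lr_iso_trans[OF GK] lr_iso_trans[OF KG] by auto
qed

end

theory Submission
  imports Defs
begin

text \<open>The argument is Marks' game. For a vertex \<open>v\<close> of \<open>H\<close> and a color \<open>i\<close>, two players build, level
  by level, a homomorphism from the tree of depth \<open>r\<close> to \<open>H\<close> with root \<open>v\<close>: Alice labels the branch
  behind the edge of color \<open>i\<close> at the root, Bob labels all other branches, and Bob wins if the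
  algorithm outputs \<open>i\<close> at the root. If Alice won for every \<open>i\<close>, then her strategies played together
  would give a homomorphism on which the algorithm outputs no color at all. So \<open>v\<close> may choose a
  color \<open>i\<close> for which Bob wins, and this choice depends only on the ball of radius \<open>r\<close> around \<open>v\<close>.
  If both ends of an edge that may carry the color \<open>i\<close> chose \<open>i\<close>, then Bob's two winning strategies,
  played against each other from the two ends, would give a homomorphism on which the algorithm
  outputs \<open>i\<close> at both ends of a tree edge of color \<open>i\<close>.\<close>

subsection \<open>Words and their right translations\<close>

lemma words_iff: "w \<in> verts (reg_tree \<Delta>) \<longleftrightarrow> set w \<subseteq> {1..\<Delta>} \<and> distinct_adj w"
  by (simp add: reg_tree_def)

lemma words_Nil [simp]: "[] \<in> verts (reg_tree \<Delta>)"
  by (simp add: words_iff)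

lemma words_single [simp]: "[i] \<in> verts (reg_tree \<Delta>) \<longleftrightarrow> i \<in> {1..\<Delta>}"
  by (simp add: words_iff)

lemma words_ConsD: "j # u \<in> verts (reg_tree \<Delta>) \<Longrightarrow> j \<in> {1..\<Delta>} \<and> u \<in> verts (reg_tree \<Delta>)"
  by (cases u) (auto simp: words_iff)

lemma finite_words_le: "finite {w \<in> verts (reg_tree \<Delta>). length w \<le> n}"
  by (rule finite_subset[OF _ finite_lists_length_le[of "{1..\<Delta>}" n]]) (auto simp: words_iff)

text \<open>Right multiplication by the generator \<open>i\<close>: the color-preserving automorphism of the tree that
  swaps the end points of the edge of color \<open>i\<close> at the root.\<close>

definition rot :: "nat \<Rightarrow> nat list \<Rightarrow> nat list" where
  "rot i w = (if w \<noteq> [] \<and> last w = i then butlast w else w @ [i])"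

lemma rot_Nil [simp]: "rot i [] = [i]" and rot_single [simp]: "rot i [i] = []"
  by (simp_all add: rot_def)

text \<open>Tree edges prepend a letter while \<open>rot\<close> acts on the last letter, so the two
  commute. The exception is the word \<open>[i]\<close>, whose only letter is both first and
  last.\<close>

lemma rot_Cons: "u \<noteq> [] \<or> j \<noteq> i \<Longrightarrow> rot i (j # u) = j # rot i u"
  by (auto simp: rot_def)

lemma length_rot_le: "length (rot i w) \<le> Suc (length w)"
  by (auto simp: rot_def)

lemma rot_words:
  assumes "i \<in> {1..\<Delta>}" "w \<in> verts (reg_tree \<Delta>)"
  shows "rot i w \<in> verts (reg_tree \<Delta>)"
proof (cases w rule: rev_cases)
  case (snoc u j)
  then show ?thesis using assms by (auto simp: rot_def words_iff distinct_adj_append_iff)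
qed (use assms in auto)

text \<open>Reducedness matters here: once a final \<open>i\<close> is deleted, the remaining word
  cannot end in \<open>i\<close>, so the second application puts it back.\<close>

lemma rot_rot:
  assumes "w \<in> verts (reg_tree \<Delta>)"
  shows "rot i (rot i w) = w"
proof (cases w rule: rev_cases)
  case (snoc u j)
  then show ?thesis using assms
    by (auto simp: rot_def words_iff distinct_adj_append_iff butlast_append)
qed simp

lemma reg_tree_edgeE:
  assumes "e \<in> edges (reg_tree \<Delta>)"
  obtains j u where "e = {u, j # u}" "j # u \<in> verts (reg_tree \<Delta>)"
  using assms by (auto simp: reg_tree_def Let_def)

lemma rot_edge:
  assumes "i \<in> {1..\<Delta>}" "e \<in> edges (reg_tree \<Delta>)"
  shows "rot i ` e \<in> edges (reg_tree \<Delta>) \<and> tree_color (rot i ` e) = tree_color e"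
proof -
  obtain j u where e: "e = {u, j # u}" "j # u \<in> verts (reg_tree \<Delta>)"
    using assms(2) by (rule reg_tree_edgeE)
  show ?thesis
  proof (cases "u \<noteq> [] \<or> j \<noteq> i")
    case True
    then have "rot i ` e = {rot i u, j # rot i u}" "j # rot i u \<in> verts (reg_tree \<Delta>)"
      using e rot_Cons[OF True] rot_words[OF assms(1) e(2)] by auto
    then show ?thesis using e reg_tree_edgeI by simp
  next
    case False
    \<comment> \<open>This is the edge between \<open>[]\<close> and \<open>[i]\<close>; its ends
      are swapped.\<close>
    then have "rot i ` e = e" using e by auto
    then show ?thesis using assms by simp
  qed
qed

subsection \<open>The game\<close>

text \<open>The target is a set with one relation per tree color. Labelings are total functions
  whose values beyond depth \<open>k\<close> are irrelevant, which is why positions are compared by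
  \<open>agree\<close> and not by equality.\<close>

definition tree_hom :: "nat \<Rightarrow> (nat \<Rightarrow> 'a rel) \<Rightarrow> nat \<Rightarrow> (nat list \<Rightarrow> 'a) \<Rightarrow> bool" where
  "tree_hom \<Delta> R k \<phi> \<longleftrightarrow>
     (\<forall>j u. j # u \<in> verts (reg_tree \<Delta>) \<longrightarrow> length u < k \<longrightarrow> (\<phi> u, \<phi> (j # u)) \<in> R j)"

definition agree :: "nat \<Rightarrow> nat \<Rightarrow> (nat list \<Rightarrow> 'a) \<Rightarrow> (nat list \<Rightarrow> 'a) \<Rightarrow> bool" where
  "agree \<Delta> k \<phi> \<psi> \<longleftrightarrow> (\<forall>w\<in>verts (reg_tree \<Delta>). length w \<le> k \<longrightarrow> \<phi> w = \<psi> w)"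

text \<open>The labeling \<open>\<phi>\<close> has been fixed up to depth \<open>k\<close>, and \<open>n\<close> more levels are to be played. On
  each level Alice first labels the words ending in \<open>i\<close>, that is, the branch of the \<open>i\<close>-th neighbor
  of the root (recall that words grow on the left); then Bob labels the rest. Bob wins if the
  output \<open>Out\<close> is \<open>i\<close>.\<close>

primrec bob_wins :: "nat \<Rightarrow> (nat \<Rightarrow> 'a rel) \<Rightarrow> ((nat list \<Rightarrow> 'a) \<Rightarrow> nat option) \<Rightarrow> nat \<Rightarrow>
    nat \<Rightarrow> nat \<Rightarrow> (nat list \<Rightarrow> 'a) \<Rightarrow> bool" where
  "bob_wins \<Delta> R Out i 0 k \<phi> \<longleftrightarrow> Out \<phi> = Some i"
| "bob_wins \<Delta> R Out i (Suc n) k \<phi> \<longleftrightarrow>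
     (\<forall>\<alpha>. (\<forall>j u. j # u \<in> verts (reg_tree \<Delta>) \<longrightarrow> length u = k \<longrightarrow> last (j # u) = i \<longrightarrow>
             (\<phi> u, \<alpha> (j # u)) \<in> R j) \<longrightarrow>
        (\<exists>\<beta>. tree_hom \<Delta> R (Suc k) \<beta> \<and> agree \<Delta> k \<phi> \<beta> \<and>
           (\<forall>w\<in>verts (reg_tree \<Delta>). length w = Suc k \<longrightarrow> last w = i \<longrightarrow> \<beta> w = \<alpha> w) \<and>
           bob_wins \<Delta> R Out i n (Suc k) \<beta>))"

section \<open>What a position of the game depends on\<close>

lemma tree_hom_agree:
  assumes "tree_hom \<Delta> R k \<phi>" "agree \<Delta> k \<phi> \<psi>"
  shows "tree_hom \<Delta> R k \<psi>"
  using assms unfolding tree_hom_def agree_def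
  by (metis words_ConsD Suc_leI length_Cons less_imp_le)

lemma agree_sym: "agree \<Delta> k \<phi> \<psi> \<Longrightarrow> agree \<Delta> k \<psi> \<phi>"
  by (simp add: agree_def)

lemma agree_trans: "agree \<Delta> k \<phi> \<psi> \<Longrightarrow> agree \<Delta> k \<psi> \<chi> \<Longrightarrow> agree \<Delta> k \<phi> \<chi>"
  by (simp add: agree_def)

lemma agree_mono: "agree \<Delta> k \<phi> \<psi> \<Longrightarrow> m \<le> k \<Longrightarrow> agree \<Delta> m \<phi> \<psi>"
  by (auto simp: agree_def)

text \<open>A position enters the later play only through its labels up to depth \<open>k\<close>,
  so Bob's answer at \<open>\<phi>\<close> serves unchanged at \<open>\<psi>\<close>. A case
  distinction on \<open>n\<close> therefore suffices, without induction.\<close>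

lemma bob_wins_agree:
  assumes Out: "\<And>\<phi> \<psi>. agree \<Delta> (k + n) \<phi> \<psi> \<Longrightarrow> Out \<phi> = Out \<psi>"
    and a: "agree \<Delta> k \<phi> \<psi>" and b: "bob_wins \<Delta> R Out i n k \<phi>"
  shows "bob_wins \<Delta> R Out i n k \<psi>"
proof (cases n)
  case 0
  then show ?thesis using Out[of \<phi> \<psi>] a b by simp
next
  case (Suc m)
  have eq: "\<phi> u = \<psi> u" if "j # u \<in> verts (reg_tree \<Delta>)" "length u = k" for j u
    using a that words_ConsD unfolding agree_def by blast
  have ag: "agree \<Delta> k \<psi> \<beta>" if "agree \<Delta> k \<phi> \<beta>" for \<beta>
    using a that agree_sym agree_trans by blast
  show ?thesis
    unfolding Suc bob_wins.simps
  proof (intro allI impI)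
    fix \<alpha>
    assume "\<forall>j u. j # u \<in> verts (reg_tree \<Delta>) \<longrightarrow> length u = k \<longrightarrow> last (j # u) = i \<longrightarrow>
      (\<psi> u, \<alpha> (j # u)) \<in> R j"
    then have "\<forall>j u. j # u \<in> verts (reg_tree \<Delta>) \<longrightarrow> length u = k \<longrightarrow> last (j # u) = i \<longrightarrow>
      (\<phi> u, \<alpha> (j # u)) \<in> R j"
      using eq by metis
    with b[unfolded Suc bob_wins.simps]
    show "\<exists>\<beta>. tree_hom \<Delta> R (Suc k) \<beta> \<and> agree \<Delta> k \<psi> \<beta> \<and>
           (\<forall>w\<in>verts (reg_tree \<Delta>). length w = Suc k \<longrightarrow> last w = i \<longrightarrow> \<beta> w = \<alpha> w) \<and>
           bob_wins \<Delta> R Out i m (Suc k) \<beta>"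
      using ag by blast
  qed
qed

text \<open>Each nonempty word has exactly one last letter, so Alice's moves in the games for all
  colors partition the next level. Together they fill it, and in each single game the moves of the
  others count as Bob's answer.\<close>

lemma combine_alice:
  assumes "tree_hom \<Delta> R k \<phi>" "\<forall>i\<in>{1..\<Delta>}. \<not> bob_wins \<Delta> R Out i n k \<phi>"
  shows "\<exists>\<psi>. tree_hom \<Delta> R (k + n) \<psi> \<and> agree \<Delta> k \<phi> \<psi> \<and> (\<forall>i\<in>{1..\<Delta>}. Out \<psi> \<noteq> Some i)"
  using assms
proof (induction n arbitrary: k \<phi>)
  case 0
  then show ?case by (intro exI[of _ \<phi>]) (auto simp: agree_def)
next
  case (Suc n)
  \<comment> \<open>That Bob does not win means that Alice has a legal move to which every answer
    leads to a position he does not win.\<close>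
  have "\<forall>i\<in>{1..\<Delta>}. \<exists>\<alpha>.
      (\<forall>j u. j # u \<in> verts (reg_tree \<Delta>) \<longrightarrow> length u = k \<longrightarrow> last (j # u) = i \<longrightarrow>
         (\<phi> u, \<alpha> (j # u)) \<in> R j) \<and>
      (\<forall>\<beta>. tree_hom \<Delta> R (Suc k) \<beta> \<longrightarrow> agree \<Delta> k \<phi> \<beta> \<longrightarrow>
         (\<forall>w\<in>verts (reg_tree \<Delta>). length w = Suc k \<longrightarrow> last w = i \<longrightarrow> \<beta> w = \<alpha> w) \<longrightarrow>
         \<not> bob_wins \<Delta> R Out i n (Suc k) \<beta>)"
    using Suc.prems(2) unfolding bob_wins.simps by blast
  then obtain a where
    legal: "\<And>i j u. i \<in> {1..\<Delta>} \<Longrightarrow> j # u \<in> verts (reg_tree \<Delta>) \<Longrightarrow> length u = k \<Longrightarrow>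
      last (j # u) = i \<Longrightarrow> (\<phi> u, a i (j # u)) \<in> R j" and
    win: "\<And>i \<beta>. i \<in> {1..\<Delta>} \<Longrightarrow> tree_hom \<Delta> R (Suc k) \<beta> \<Longrightarrow> agree \<Delta> k \<phi> \<beta> \<Longrightarrow>
      (\<forall>w\<in>verts (reg_tree \<Delta>). length w = Suc k \<longrightarrow> last w = i \<longrightarrow> \<beta> w = a i w) \<Longrightarrow>
      \<not> bob_wins \<Delta> R Out i n (Suc k) \<beta>"
    by (subst (asm) bchoice_iff) blast
  \<comment> \<open>The last letter of a word decides which of Alice's moves labels it.\<close>
  define \<beta> where "\<beta> w = (if length w \<le> k then \<phi> w else a (last w) w)" for w
  have \<beta>: "agree \<Delta> k \<phi> \<beta>" by (simp add: agree_def \<beta>_def)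
  have hom: "tree_hom \<Delta> R (Suc k) \<beta>"
    unfolding tree_hom_def
  proof (intro allI impI)
    fix j u assume ju: "j # u \<in> verts (reg_tree \<Delta>)" "length u < Suc k"
    show "(\<beta> u, \<beta> (j # u)) \<in> R j"
    proof (cases "length u < k")
      case True
      then show ?thesis using Suc.prems(1) ju by (simp add: tree_hom_def \<beta>_def)
    next
      case False
      have "last (j # u) \<in> {1..\<Delta>}"
        using ju(1) last_in_set[of "j # u"] by (auto simp: words_iff)
      then show ?thesis using False ju legal[of "last (j # u)" j u] by (simp add: \<beta>_def)
    qed
  qed
  have "\<forall>i\<in>{1..\<Delta>}. \<not> bob_wins \<Delta> R Out i n (Suc k) \<beta>"
  proof
    fix i assume "i \<in> {1..\<Delta>}"
    then show "\<not> bob_wins \<Delta> R Out i n (Suc k) \<beta>" by (rule win[OF _ hom \<beta>]) (simp add: \<beta>_def)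
  qed
  from Suc.IH[OF hom this] obtain \<psi> where
    "tree_hom \<Delta> R (Suc k + n) \<psi>" "agree \<Delta> (Suc k) \<beta> \<psi>" "\<forall>i\<in>{1..\<Delta>}. Out \<psi> \<noteq> Some i"
    by blast
  moreover from this have "agree \<Delta> k \<phi> \<psi>"
    using agree_trans[OF \<beta> agree_mono] by simp
  ultimately show ?case by auto
qed

text \<open>Bob's strategies from the two ends of an edge of color \<open>i\<close> play against each other: the move
  of Alice on level \<open>k + 1\<close> at one end is what Bob played on level \<open>k\<close> at the other end.\<close>

lemma combine_bob:
  assumes Out: "\<And>\<phi> \<psi>. agree \<Delta> (k + n) \<phi> \<psi> \<Longrightarrow> Out \<phi> = Out \<psi>"
    and i: "i \<in> {1..\<Delta>}" and sym: "sym (R i)"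
    and "tree_hom \<Delta> R k \<theta>" "tree_hom \<Delta> R k (\<theta> \<circ> rot i)" "(\<theta> [], \<theta> [i]) \<in> R i"
    and "bob_wins \<Delta> R Out i n k \<theta>" "bob_wins \<Delta> R Out i n k (\<theta> \<circ> rot i)"
  shows "\<exists>\<psi>. tree_hom \<Delta> R (k + n) \<psi> \<and> tree_hom \<Delta> R (k + n) (\<psi> \<circ> rot i) \<and>
    \<psi> [] = \<theta> [] \<and> \<psi> [i] = \<theta> [i] \<and> Out \<psi> = Some i \<and> Out (\<psi> \<circ> rot i) = Some i"
  using assms(1,4-)
proof (induction n arbitrary: k \<theta>)
  case 0
  then show ?case by (intro exI[of _ \<theta>]) simp
next
  case (Suc n)
  \<comment> \<open>\<open>\<phi>\<close> itself serves as Alice's move. It is legal on words of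
    length \<open>Suc k\<close> ending in \<open>i\<close>, because \<open>rot i\<close> brings them
    to depth \<open>k\<close>, where \<open>\<phi> \<circ> rot i\<close> is a homomorphism.\<close>
  have half: "\<exists>\<beta>. tree_hom \<Delta> R (Suc k) \<beta> \<and> agree \<Delta> k \<phi> \<beta> \<and>
      (\<forall>w\<in>verts (reg_tree \<Delta>). length w = Suc k \<longrightarrow> last w = i \<longrightarrow> \<beta> w = \<phi> w) \<and>
      bob_wins \<Delta> R Out i n (Suc k) \<beta>"
    if hom: "tree_hom \<Delta> R k (\<phi> \<circ> rot i)" and e: "(\<phi> [], \<phi> [i]) \<in> R i"
      and b: "bob_wins \<Delta> R Out i (Suc n) k \<phi>" for \<phi>
  proof (rule b[unfolded bob_wins.simps, rule_format])
    fix j u assume ju: "j # u \<in> verts (reg_tree \<Delta>)" "length u = k" "last (j # u) = i"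
    show "(\<phi> u, \<phi> (j # u)) \<in> R j"
    proof (cases "u = []")
      \<comment> \<open>Here \<open>k = 0\<close>: the edge is the root edge of color
        \<open>i\<close>, about which homomorphisms of depth 0 say nothing.\<close>
      case True
      then show ?thesis using e ju by simp
    next
      case False
      have "j # rot i u = rot i (j # u)" using False by (simp add: rot_Cons)
      then have "j # rot i u \<in> verts (reg_tree \<Delta>)" "length (rot i u) < k"
        using rot_words[OF i ju(1)] False ju(2,3) by (auto simp: rot_def)
      then have "((\<phi> \<circ> rot i) (rot i u), (\<phi> \<circ> rot i) (j # rot i u)) \<in> R j"
        using hom unfolding tree_hom_def by blast
      moreover have "rot i (rot i u) = u" "rot i (j # rot i u) = j # u"
        using rot_rot words_ConsD[OF ju(1)] rot_rot[OF ju(1)] False by (auto simp: rot_Cons)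
      ultimately show ?thesis by simp
    qed
  qed
  obtain \<beta>1 where \<beta>1: "tree_hom \<Delta> R (Suc k) \<beta>1" "agree \<Delta> k \<theta> \<beta>1"
    "\<forall>w\<in>verts (reg_tree \<Delta>). length w = Suc k \<longrightarrow> last w = i \<longrightarrow> \<beta>1 w = \<theta> w"
    "bob_wins \<Delta> R Out i n (Suc k) \<beta>1"
    using half[of \<theta>] Suc.prems by blast
  \<comment> \<open>Since \<open>rot i\<close> is an involution on reduced words, the position seen
    from the other end satisfies the same hypotheses with the two ends exchanged.\<close>
  have "tree_hom \<Delta> R k ((\<theta> \<circ> rot i) \<circ> rot i)"
    by (rule tree_hom_agree[OF Suc.prems(2)]) (simp add: agree_def rot_rot)
  moreover have "((\<theta> \<circ> rot i) [], (\<theta> \<circ> rot i) [i]) \<in> R i"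
    using Suc.prems(4) sym by (simp add: symD)
  ultimately obtain \<beta>2 where \<beta>2: "tree_hom \<Delta> R (Suc k) \<beta>2" "agree \<Delta> k (\<theta> \<circ> rot i) \<beta>2"
    "\<forall>w\<in>verts (reg_tree \<Delta>). length w = Suc k \<longrightarrow> last w = i \<longrightarrow> \<beta>2 w = \<theta> (rot i w)"
    "bob_wins \<Delta> R Out i n (Suc k) \<beta>2"
    using half[of "\<theta> \<circ> rot i"] Suc.prems(6) unfolding comp_apply by blast
  \<comment> \<open>Words ending in \<open>i\<close> lie beyond the root edge of color
    \<open>i\<close> and are labeled by Bob's answer at the other end; all other words follow his
    answer at this end.\<close>
  define \<chi> where "\<chi> w = (if w \<noteq> [] \<and> last w = i then \<beta>2 (rot i w) else \<beta>1 w)" for w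
  have a1: "agree \<Delta> (Suc k) \<beta>1 \<chi>"
    unfolding agree_def
  proof (intro ballI impI)
    fix w assume w: "w \<in> verts (reg_tree \<Delta>)" "length w \<le> Suc k"
    show "\<beta>1 w = \<chi> w"
    proof (cases "w \<noteq> [] \<and> last w = i")
      case True
      \<comment> \<open>Words ending in \<open>i\<close> are one level closer to the other end, so
        \<open>\<beta>2\<close> still copies \<open>\<theta>\<close> there; \<open>\<beta>1\<close>
        does so because Alice's move was \<open>\<theta>\<close>.\<close>
      then have "length (rot i w) \<le> k" using w by (auto simp: rot_def)
      then have "\<beta>2 (rot i w) = \<theta> w"
        using \<beta>2(2) rot_words[OF i w(1)] rot_rot[OF w(1)] unfolding agree_def by fastforce
      moreover have "\<beta>1 w = \<theta> w"
        using \<beta>1(2,3) w True unfolding agree_def by (metis le_Suc_eq)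
      ultimately show ?thesis using True by (simp add: \<chi>_def)
    qed (auto simp: \<chi>_def)
  qed
  have a2: "agree \<Delta> (Suc k) \<beta>2 (\<chi> \<circ> rot i)"
    unfolding agree_def
  proof (intro ballI impI)
    fix w assume w: "w \<in> verts (reg_tree \<Delta>)" "length w \<le> Suc k"
    show "\<beta>2 w = (\<chi> \<circ> rot i) w"
    proof (cases "w \<noteq> [] \<and> last w = i")
      case True
      then obtain u where u: "w = u @ [i]" by (metis append_butlast_last_id)
      then have r: "rot i w = u" and "u = [] \<or> last u \<noteq> i"
        using w(1) by (auto simp: rot_def words_iff distinct_adj_append_iff)
      then have "\<chi> (rot i w) = \<beta>1 u" by (auto simp: \<chi>_def)
      moreover have "\<beta>1 u = \<theta> u"
        using \<beta>1(2) u w(2) rot_words[OF i w(1)] r unfolding agree_def by simp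
      moreover have "\<beta>2 w = \<theta> (rot i w)"
        using \<beta>2(2,3) w True unfolding agree_def by (metis comp_apply le_Suc_eq)
      ultimately show ?thesis using r by simp
    next
      case False
      then have "rot i w = w @ [i]" by (auto simp: rot_def)
      then show ?thesis using rot_rot[OF w(1), of i] by (simp add: \<chi>_def)
    qed
  qed
  have ends: "\<chi> [] = \<theta> []" "\<chi> [i] = \<theta> [i]"
    using \<beta>1(2) \<beta>2(2)[unfolded agree_def, rule_format, of "[]"] by (simp_all add: \<chi>_def agree_def)
  have "\<exists>\<psi>. tree_hom \<Delta> R (Suc k + n) \<psi> \<and> tree_hom \<Delta> R (Suc k + n) (\<psi> \<circ> rot i) \<and>
    \<psi> [] = \<chi> [] \<and> \<psi> [i] = \<chi> [i] \<and> Out \<psi> = Some i \<and> Out (\<psi> \<circ> rot i) = Some i"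
  proof (rule Suc.IH)
    show *: "Out \<phi> = Out \<psi>" if "agree \<Delta> (Suc k + n) \<phi> \<psi>" for \<phi> \<psi>
      using Suc.prems(1)[of \<phi> \<psi>] that by simp
    show "tree_hom \<Delta> R (Suc k) \<chi>" "tree_hom \<Delta> R (Suc k) (\<chi> \<circ> rot i)"
      using \<beta>1(1) \<beta>2(1) a1 a2 tree_hom_agree by blast+
    show "(\<chi> [], \<chi> [i]) \<in> R i" using Suc.prems(4) ends by simp
    show "bob_wins \<Delta> R Out i n (Suc k) \<chi>" by (rule bob_wins_agree[OF * a1 \<beta>1(4)])
    show "bob_wins \<Delta> R Out i n (Suc k) (\<chi> \<circ> rot i)" by (rule bob_wins_agree[OF * a2 \<beta>2(4)])
  qed
  then show ?case unfolding ends add_Suc_shift .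
qed

text \<open>The game only explores what is reachable from the root label: \<open>B k\<close> stands for the values
  that may occur at depth \<open>k\<close>.\<close>

lemma bob_wins_local:
  assumes R: "\<And>m a b j. m < k + n \<Longrightarrow> a \<in> B m \<Longrightarrow> (a, b) \<in> R j \<longleftrightarrow> (a, b) \<in> R' j"
    and B: "\<And>m a b j. m < k + n \<Longrightarrow> a \<in> B m \<Longrightarrow> (a, b) \<in> R j \<Longrightarrow> b \<in> B (Suc m)"
    and "\<And>w. w \<in> verts (reg_tree \<Delta>) \<Longrightarrow> length w \<le> k \<Longrightarrow> \<phi> w \<in> B (length w)"
  shows "bob_wins \<Delta> R Out i n k \<phi> \<longleftrightarrow> bob_wins \<Delta> R' Out i n k \<phi>"
  using assms
proof (induction n arbitrary: k \<phi>)
  case 0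
  then show ?case by simp
next
  case (Suc n)
  have \<alpha>: "(\<phi> u, x) \<in> R j \<longleftrightarrow> (\<phi> u, x) \<in> R' j"
    if "j # u \<in> verts (reg_tree \<Delta>)" "length u = k" for j u x
  proof (rule Suc.prems(1))
    show "\<phi> u \<in> B k" using Suc.prems(3)[of u] words_ConsD[OF that(1)] that(2) by simp
  qed simp
  have Bu: "\<beta> u \<in> B (length u)"
    if "agree \<Delta> k \<phi> \<beta>" "j # u \<in> verts (reg_tree \<Delta>)" "length u < Suc k" for \<beta> u j
    using Suc.prems(3)[of u] that(1,3) words_ConsD[OF that(2)] by (simp add: agree_def)
  have "tree_hom \<Delta> R (Suc k) \<beta> \<longleftrightarrow> tree_hom \<Delta> R' (Suc k) \<beta>" if "agree \<Delta> k \<phi> \<beta>" for \<beta>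
  proof -
    have "(\<beta> u, \<beta> (j # u)) \<in> R j \<longleftrightarrow> (\<beta> u, \<beta> (j # u)) \<in> R' j"
      if "j # u \<in> verts (reg_tree \<Delta>)" "length u < Suc k" for j u
      using Suc.prems(1)[OF _ Bu[OF \<open>agree \<Delta> k \<phi> \<beta>\<close> that]] that by simp
    then show ?thesis unfolding tree_hom_def by blast
  qed
  moreover have "bob_wins \<Delta> R Out i n (Suc k) \<beta> \<longleftrightarrow> bob_wins \<Delta> R' Out i n (Suc k) \<beta>"
    if a: "agree \<Delta> k \<phi> \<beta>" and hom: "tree_hom \<Delta> R (Suc k) \<beta>" for \<beta>
  proof (rule Suc.IH)
    show "(a, b) \<in> R j \<longleftrightarrow> (a, b) \<in> R' j" if "m < Suc k + n" "a \<in> B m" for m a b j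
      using Suc.prems(1) that by simp
    show "b \<in> B (Suc m)" if "m < Suc k + n" "a \<in> B m" "(a, b) \<in> R j" for m a b j
      using Suc.prems(2) that by simp
    \<comment> \<open>The invariant survives the round: labels on the new level are
      \<open>R\<close>-successors of labels at depth \<open>k\<close>.\<close>
    show "\<beta> w \<in> B (length w)" if w: "w \<in> verts (reg_tree \<Delta>)" "length w \<le> Suc k" for w
    proof (cases w)
      case Nil
      then show ?thesis using Suc.prems(3)[of "[]"] a by (simp add: agree_def)
    next
      case (Cons j u)
      then have "\<beta> u \<in> B (length u)" "(\<beta> u, \<beta> (j # u)) \<in> R j"
        using Bu[OF a] w hom by (auto simp: tree_hom_def)
      then show ?thesis using Suc.prems(2)[of "length u"] w Cons by auto
    qed
  qed
  ultimately have \<beta>: "tree_hom \<Delta> R (Suc k) \<beta> \<and> agree \<Delta> k \<phi> \<beta> \<and> P \<beta> \<and> bob_wins \<Delta> R Out i n (Suc k) \<beta> \<longleftrightarrow>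
      tree_hom \<Delta> R' (Suc k) \<beta> \<and> agree \<Delta> k \<phi> \<beta> \<and> P \<beta> \<and> bob_wins \<Delta> R' Out i n (Suc k) \<beta>" for P \<beta>
    by blast
  have \<alpha>': "(\<forall>j u. j # u \<in> verts (reg_tree \<Delta>) \<longrightarrow> length u = k \<longrightarrow> last (j # u) = i \<longrightarrow>
        (\<phi> u, \<alpha> (j # u)) \<in> R j) \<longleftrightarrow>
      (\<forall>j u. j # u \<in> verts (reg_tree \<Delta>) \<longrightarrow> length u = k \<longrightarrow> last (j # u) = i \<longrightarrow>
        (\<phi> u, \<alpha> (j # u)) \<in> R' j)" for \<alpha>
    using \<alpha> by blast
  show ?case
    unfolding bob_wins.simps \<alpha>' by (intro iff_allI imp_cong refl ex_cong1 \<beta>)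
qed

text \<open>The game fixes labels up to depth \<open>r\<close>, but the algorithm is only guaranteed
  to succeed on homomorphisms of depth \<open>Suc r\<close>. Each label in \<open>S\<close> has a
  successor for every color, again in \<open>S\<close>, so a partial homomorphism can be continued
  forever.\<close>

lemma extend_tree_hom:
  fixes R :: "nat \<Rightarrow> 'a rel"
  assumes suffix: "\<And>j u. j # u \<in> D \<Longrightarrow> u \<in> D"
    and hom: "\<And>j u. j # u \<in> verts (reg_tree \<Delta>) \<Longrightarrow> j # u \<in> D \<Longrightarrow> (\<phi> u, \<phi> (j # u)) \<in> R j"
    and root: "\<phi> [] \<in> S"
    and closed: "\<And>j a b. a \<in> S \<Longrightarrow> (a, b) \<in> R j \<Longrightarrow> b \<in> S"
    and serial: "\<And>j a. a \<in> S \<Longrightarrow> j \<in> {1..\<Delta>} \<Longrightarrow> \<exists>b. (a, b) \<in> R j"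
  obtains \<psi> where "\<And>k. tree_hom \<Delta> R k \<psi>" "\<psi> [] = \<phi> []" "\<And>w. w \<in> D \<Longrightarrow> \<psi> w = \<phi> w"
proof -
  \<comment> \<open>The tail of a word is its parent, so list recursion moves away from the root.
    \<open>D\<close> is closed under parents, so prescribed labels always sit below prescribed
    labels.\<close>
  define \<psi> where "\<psi> = rec_list (\<phi> []) (\<lambda>j u x. if j # u \<in> D then \<phi> (j # u) else SOME b. (x, b) \<in> R j)"
  have Nil: "\<psi> [] = \<phi> []"
    and Cons: "\<psi> (j # u) = (if j # u \<in> D then \<phi> (j # u) else SOME b. (\<psi> u, b) \<in> R j)" for j u
    by (simp_all add: \<psi>_def)
  have D: "\<psi> w = \<phi> w" if "w \<in> D" for w
    using that Nil Cons by (cases w) simp_all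
  have step: "(\<psi> u, \<psi> (j # u)) \<in> R j" if "j # u \<in> verts (reg_tree \<Delta>)" "\<psi> u \<in> S" for j u
  proof (cases "j # u \<in> D")
    case True
    then show ?thesis using hom that D suffix by simp
  next
    case False
    then show ?thesis using someI_ex[OF serial[OF that(2), of j]] words_ConsD[OF that(1)] Cons by simp
  qed
  have "\<psi> w \<in> S" if "w \<in> verts (reg_tree \<Delta>)" for w
    using that
  proof (induction w)
    case (Cons j u)
    then have "\<psi> u \<in> S" using words_ConsD by blast
    then show ?case using closed step Cons.prems by blast
  qed (simp add: Nil root)
  then have "tree_hom \<Delta> R k \<psi>" for k
    unfolding tree_hom_def using step words_ConsD by blast
  then show thesis using that Nil D by blast
qed

subsection \<open>Balls in the tree\<close>

text \<open>Taking the identity or \<open>rot i\<close> for \<open>\<sigma>\<close> handles the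
  balls about \<open>[]\<close> and \<open>[i]\<close> at once. The distance from
  \<open>\<sigma> []\<close> to \<open>w\<close> is \<open>length (\<sigma> w)\<close>: an edge
  changes this length by one, and deleting first letters gives a path. The last assumption keeps the
  path inside \<open>G\<close>.\<close>

lemma ball_verts_subtree:
  assumes \<sigma>: "\<And>w. w \<in> verts (reg_tree \<Delta>) \<Longrightarrow> \<sigma> w \<in> verts (reg_tree \<Delta>) \<and> \<sigma> (\<sigma> w) = w"
    and \<sigma>_edge: "\<And>e. e \<in> edges (reg_tree \<Delta>) \<Longrightarrow> \<sigma> ` e \<in> edges (reg_tree \<Delta>)"
    and G: "verts G \<subseteq> verts (reg_tree \<Delta>)" "edges G = {e \<in> edges (reg_tree \<Delta>). e \<subseteq> verts G}"
    and n: "{w \<in> verts (reg_tree \<Delta>). length (\<sigma> w) \<le> n} \<subseteq> verts G"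
  shows "ball_verts G (\<sigma> []) n = {w \<in> verts (reg_tree \<Delta>). length (\<sigma> w) \<le> n}"
proof -
  have le: "length (\<sigma> w) \<le> k" if "(\<sigma> [], w) \<in> arcs G ^^ k" for k w
    using that
  proof (induction k arbitrary: w)
    case 0
    then show ?case using \<sigma>[of "[]"] by simp
  next
    case (Suc k)
    then obtain u where u: "(\<sigma> [], u) \<in> arcs G ^^ k" "(u, w) \<in> arcs G" by auto
    then have "{u, w} \<in> edges (reg_tree \<Delta>)" using G(2) by (simp add: arcs_def)
    then have "\<sigma> ` {u, w} \<in> edges (reg_tree \<Delta>)" by (rule \<sigma>_edge)
    then have "length (\<sigma> w) \<le> Suc (length (\<sigma> u))"
      using reg_tree_arcD[of "\<sigma> u" "\<sigma> w" \<Delta>] by auto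
    then show ?case using Suc.IH[OF u(1)] by simp
  qed
  have path: "(\<sigma> [], \<sigma> v) \<in> arcs G ^^ length v"
    if "v \<in> verts (reg_tree \<Delta>)" "length v \<le> n" for v
    using that
  proof (induction v)
    case (Cons j u)
    have u: "u \<in> verts (reg_tree \<Delta>)" using Cons.prems words_ConsD by blast
    have "\<sigma> ` {u, j # u} \<in> edges (reg_tree \<Delta>)"
      using \<sigma>_edge reg_tree_edgeI Cons.prems(1) by blast
    moreover have "\<sigma> u \<in> verts G" "\<sigma> (j # u) \<in> verts G"
      using \<sigma>[OF u] \<sigma>[OF Cons.prems(1)] Cons.prems(2) n by auto
    ultimately have "(\<sigma> u, \<sigma> (j # u)) \<in> arcs G" by (simp add: arcs_def G(2))
    moreover have "(\<sigma> [], \<sigma> u) \<in> arcs G ^^ length u" using Cons u by simp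
    ultimately show ?case by auto
  qed simp
  show ?thesis
  proof (intro set_eqI iffI)
    fix w assume "w \<in> ball_verts G (\<sigma> []) n"
    then show "w \<in> {w \<in> verts (reg_tree \<Delta>). length (\<sigma> w) \<le> n}"
      using le G(1) unfolding ball_verts_def by fastforce
  next
    fix w assume w: "w \<in> {w \<in> verts (reg_tree \<Delta>). length (\<sigma> w) \<le> n}"
    then have "(\<sigma> [], w) \<in> arcs G ^^ length (\<sigma> w)" using path[of "\<sigma> w"] \<sigma>[of w] by simp
    then show "w \<in> ball_verts G (\<sigma> []) n" using w n unfolding ball_verts_def by auto
  qed
qed

lemma reg_tree_edge_subset: "e \<in> edges (reg_tree \<Delta>) \<Longrightarrow> e \<subseteq> verts (reg_tree \<Delta>)"
  using simple_reg_tree by (simp add: simple_graph_def)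

lemma verts_tree_ball: "verts (tree_ball \<Delta> n) = {w \<in> verts (reg_tree \<Delta>). length w \<le> n}"
  and edges_tree_ball:
    "edges (tree_ball \<Delta> n) = {e \<in> edges (reg_tree \<Delta>). e \<subseteq> verts (tree_ball \<Delta> n)}"
proof -
  have ball: "ball_verts (reg_tree \<Delta>) [] n = {w \<in> verts (reg_tree \<Delta>). length w \<le> n}"
    using ball_verts_subtree[of \<Delta> id "reg_tree \<Delta>" n] reg_tree_edge_subset by auto
  then show v: "verts (tree_ball \<Delta> n) = {w \<in> verts (reg_tree \<Delta>). length w \<le> n}"
    by (auto simp: tree_ball_def gball_def induced_def)
  show "edges (tree_ball \<Delta> n) = {e \<in> edges (reg_tree \<Delta>). e \<subseteq> verts (tree_ball \<Delta> n)}"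
    unfolding v by (simp add: tree_ball_def gball_def induced_def ball)
qed

lemma gball_tree_ball:
  "gball (tree_ball \<Delta> (Suc r)) [] r = tree_ball \<Delta> r"
proof -
  have V: "{w \<in> verts (reg_tree \<Delta>). length (id w) \<le> r} \<subseteq> verts (tree_ball \<Delta> (Suc r))"
    by (auto simp: verts_tree_ball)
  have ball: "ball_verts (tree_ball \<Delta> (Suc r)) [] r = {w \<in> verts (reg_tree \<Delta>). length w \<le> r}"
    using ball_verts_subtree[of \<Delta> id "tree_ball \<Delta> (Suc r)" r, OF _ _ _ edges_tree_ball V]
    by (simp add: verts_tree_ball)
  show ?thesis
    using edges_tree_ball[of \<Delta> r] edges_tree_ball[of \<Delta> "Suc r"]
    unfolding gball_def induced_def ball
    by (intro ugraph.equality) (auto simp: verts_tree_ball)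
qed

lemma gball_tree_ball_rot:
  assumes "i \<in> {1..\<Delta>}"
  shows "verts (gball (tree_ball \<Delta> (Suc r)) [i] r) = rot i ` verts (tree_ball \<Delta> r)"
    and "edges (gball (tree_ball \<Delta> (Suc r)) [i] r) = (`) (rot i) ` edges (tree_ball \<Delta> r)"
proof -
  let ?W = "verts (reg_tree \<Delta>)"
  let ?V = "{w \<in> ?W. length (rot i w) \<le> r}"
  \<comment> \<open>\<open>rot i\<close> changes the depth by at most one, so the ball of radius
    \<open>r\<close> about \<open>[i]\<close> fits into the tree ball of radius
    \<open>Suc r\<close>.\<close>
  have V: "?V \<subseteq> verts (tree_ball \<Delta> (Suc r))"
  proof
    fix w assume w: "w \<in> ?V"
    then have "length w \<le> Suc (length (rot i w))"
      using length_rot_le[of i "rot i w"] rot_rot[of w \<Delta> i] by simp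
    then show "w \<in> verts (tree_ball \<Delta> (Suc r))" using w by (simp add: verts_tree_ball)
  qed
  have ball: "ball_verts (tree_ball \<Delta> (Suc r)) [i] r = ?V"
    using ball_verts_subtree[of \<Delta> "rot i" "tree_ball \<Delta> (Suc r)" r, OF _ _ _ edges_tree_ball V]
      rot_words[OF assms] rot_rot rot_edge[OF assms]
    by (auto simp: verts_tree_ball)
  have img: "?V = rot i ` verts (tree_ball \<Delta> r)"
  proof
    show "?V \<subseteq> rot i ` verts (tree_ball \<Delta> r)"
    proof
      fix w assume "w \<in> ?V"
      then show "w \<in> rot i ` verts (tree_ball \<Delta> r)"
        using rot_words[OF assms] rot_rot[of w \<Delta> i]
        by (intro image_eqI[of _ _ "rot i w"]) (auto simp: verts_tree_ball)
    qed
  qed (auto simp: verts_tree_ball rot_words[OF assms] rot_rot)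
  have edges: "edges (gball (tree_ball \<Delta> (Suc r)) [i] r) = {e \<in> edges (reg_tree \<Delta>). e \<subseteq> ?V}"
    using edges_tree_ball[of \<Delta> "Suc r"] V unfolding gball_def induced_def ball by auto
  show "verts (gball (tree_ball \<Delta> (Suc r)) [i] r) = rot i ` verts (tree_ball \<Delta> r)"
    using V img by (auto simp: gball_def induced_def ball)
  show "edges (gball (tree_ball \<Delta> (Suc r)) [i] r) = (`) (rot i) ` edges (tree_ball \<Delta> r)"
  proof
    show "edges (gball (tree_ball \<Delta> (Suc r)) [i] r) \<subseteq> (`) (rot i) ` edges (tree_ball \<Delta> r)"
    proof
      fix e assume "e \<in> edges (gball (tree_ball \<Delta> (Suc r)) [i] r)"
      then have e: "e \<in> edges (reg_tree \<Delta>)" "e \<subseteq> ?V" by (simp_all add: edges)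
      have "rot i ` rot i ` e = (\<lambda>w. w) ` e"
        unfolding image_image using e(2) by (intro image_cong) (auto simp: rot_rot)
      moreover have "rot i ` e \<subseteq> verts (tree_ball \<Delta> r)"
        using e(2) rot_words[OF assms] by (auto simp: verts_tree_ball)
      ultimately show "e \<in> (`) (rot i) ` edges (tree_ball \<Delta> r)"
        using rot_edge[OF assms e(1)] edges_tree_ball[of \<Delta> r]
        by (intro image_eqI[of _ _ "rot i ` e"]) auto
    qed
    show "(`) (rot i) ` edges (tree_ball \<Delta> r) \<subseteq> edges (gball (tree_ball \<Delta> (Suc r)) [i] r)"
      unfolding edges img using rot_edge[OF assms] edges_tree_ball[of \<Delta> r] by blast
  qed
qed

section \<open>Outputs at the root and at its neighbors\<close>

lemma run_root_agree:
  fixes lab lab' :: "nat list \<Rightarrow> 'l" and tc :: "nat list set \<Rightarrow> 'e"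
  assumes "agree \<Delta> r lab lab'"
  shows "run A r (tree_ball \<Delta> (Suc r)) lab tc [] = run A r (tree_ball \<Delta> (Suc r)) lab' tc []"
proof -
  have "lab w = lab' w" if "w \<in> verts (tree_ball \<Delta> r)" for w
    using assms that by (simp add: agree_def verts_tree_ball)
  \<comment> \<open>\<open>lr_iso\<close> reads labels only on the ball, so both views have the same
    isomorphic copies.\<close>
  then have "lr_iso (view (tree_ball \<Delta> (Suc r)) lab tc r []) K \<longleftrightarrow>
      lr_iso (view (tree_ball \<Delta> (Suc r)) lab' tc r []) K" for K :: "(nat, 'l, 'e) lrgraph"
    unfolding lr_iso_def view_def gball_tree_ball by auto
  then show ?thesis by (simp add: run_def iso_class_def)
qed

text \<open>\<open>rot i\<close> is an isomorphism from the root's view of the rotated labeling to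
  the view of \<open>[i]\<close>. This lets the game speak about outputs at the root only.\<close>

lemma run_neighbor:
  fixes lab :: "nat list \<Rightarrow> 'l" and q :: "nat \<Rightarrow> 'e"
  assumes i: "i \<in> {1..\<Delta>}"
  shows "run A r (tree_ball \<Delta> (Suc r)) lab (q \<circ> tree_color) [i] =
    run A r (tree_ball \<Delta> (Suc r)) (lab \<circ> rot i) (q \<circ> tree_color) []"
proof -
  let ?G = "view (tree_ball \<Delta> (Suc r)) (lab \<circ> rot i) (q \<circ> tree_color) r []"
  let ?K = "view (tree_ball \<Delta> (Suc r)) lab (q \<circ> tree_color) r [i]"
  have G: "verts ?G = verts (tree_ball \<Delta> r)" "edges ?G = edges (tree_ball \<Delta> r)"
    by (simp_all add: view_def gball_tree_ball)
  have K: "verts ?K = rot i ` verts (tree_ball \<Delta> r)" "edges ?K = (`) (rot i) ` edges (tree_ball \<Delta> r)"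
    using gball_tree_ball_rot[OF i, of r] by (simp_all add: view_def)
  have "inj_on (rot i) (verts (tree_ball \<Delta> r))"
    by (rule inj_on_inverseI[of _ "rot i"]) (auto simp: verts_tree_ball rot_rot)
  then have "lr_iso ?G ?K"
    unfolding lr_iso_def G K using rot_edge[OF i] edges_tree_ball[of \<Delta> r]
    by (intro exI[of _ "rot i"]) (auto simp: bij_betw_def view_def)
  moreover have "finite (verts ?G)" "\<forall>e\<in>edges ?G. e \<subseteq> verts ?G" "base ?G \<in> verts ?G"
    unfolding G using edges_tree_ball[of \<Delta> r] finite_words_le[of \<Delta> r]
    by (auto simp: verts_tree_ball view_def)
  moreover have "\<forall>e\<in>edges ?K. e \<subseteq> verts ?K"
    unfolding K using edges_tree_ball[of \<Delta> r] by auto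
  moreover have "base ?K \<in> verts ?K"
    unfolding K by (intro image_eqI[of _ _ "[]"]) (auto simp: verts_tree_ball view_def)
  ultimately have "iso_class ?G = iso_class ?K" using iso_class_eq_iff[of ?G ?K] by blast
  then show ?thesis by (simp add: run_def)
qed

subsection \<open>From the game to a local rule\<close>

text \<open>The game is played on labels, not on vertices, so it can be read off the isomorphism
  class of a view. The game color \<open>j\<close> only demands the edge label \<open>q j\<close>; a
  constant \<open>q\<close> makes all these relations equal.\<close>

definition label_rel :: "(nat \<Rightarrow> 'e) \<Rightarrow> ('v \<Rightarrow> 'l) \<Rightarrow> ('v set \<Rightarrow> 'e) \<Rightarrow> 'v set set \<Rightarrow> nat \<Rightarrow> 'l rel" where
  "label_rel q lab el E j = {(lab a, lab b) | a b. {a, b} \<in> E \<and> el {a, b} = q j}"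

lemma sym_label_rel: "sym (label_rel q lab el E j)"
proof (rule symI)
  fix x y assume "(x, y) \<in> label_rel q lab el E j"
  then obtain a b where "x = lab a" "y = lab b" "{b, a} \<in> E" "el {b, a} = q j"
    by (auto simp: label_rel_def insert_commute)
  then show "(y, x) \<in> label_rel q lab el E j" unfolding label_rel_def by blast
qed

text \<open>The value 1 is only relevant for isolated vertices.\<close>

definition view_color :: "nat \<Rightarrow> nat \<Rightarrow> (nat \<Rightarrow> 'e) \<Rightarrow> ((nat list \<Rightarrow> 'l) \<Rightarrow> nat option) \<Rightarrow>
    ('v, 'l, 'e) lrgraph \<Rightarrow> nat" where
  "view_color \<Delta> r q Out G =
     (let win = (\<lambda>i. i \<in> {1..\<Delta>} \<and> bob_wins \<Delta> (label_rel q (vlab G) (elab G) (edges G)) Out i r 0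
                       (\<lambda>_. vlab G (base G)))
      in if \<exists>i. win i then SOME i. win i else 1)"

lemma label_rel_iso:
  assumes "lr_iso G K" "\<forall>e\<in>edges G. e \<subseteq> verts G"
  shows "label_rel q (vlab G) (elab G) (edges G) j \<subseteq> label_rel q (vlab K) (elab K) (edges K) j"
proof -
  obtain f where f: "(`) f ` edges G = edges K" "\<forall>v\<in>verts G. vlab K (f v) = vlab G v"
    "\<forall>e\<in>edges G. elab K (f ` e) = elab G e"
    using assms(1) unfolding lr_iso_def by blast
  show ?thesis
  proof
    fix p assume "p \<in> label_rel q (vlab G) (elab G) (edges G) j"
    then obtain a b where ab: "p = (vlab G a, vlab G b)" "{a, b} \<in> edges G" "elab G {a, b} = q j"
      by (auto simp: label_rel_def)
    then have "f ` {a, b} \<in> edges K" using f(1) by blast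
    moreover have "elab K (f ` {a, b}) = q j" "p = (vlab K (f a), vlab K (f b))"
      using ab f(2,3) assms(2) by auto
    ultimately show "p \<in> label_rel q (vlab K) (elab K) (edges K) j"
      unfolding label_rel_def by auto
  qed
qed

text \<open>Isomorphic views yield the same game, so even \<open>SOME\<close> is applied to the same
  predicate.\<close>

lemma view_color_iso:
  assumes "lr_iso G K" "\<forall>e\<in>edges G. e \<subseteq> verts G" "base G \<in> verts G" "\<forall>e\<in>edges K. e \<subseteq> verts K"
  shows "view_color \<Delta> r q Out G = view_color \<Delta> r q Out K"
proof -
  have "label_rel q (vlab G) (elab G) (edges G) = label_rel q (vlab K) (elab K) (edges K)"
    using label_rel_iso[OF assms(1,2)] label_rel_iso[OF lr_iso_sym[OF assms(1-3)] assms(4)]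
    by (intro ext subset_antisym)
  moreover have "vlab G (base G) = vlab K (base K)"
    using assms(1,3) by (auto simp: lr_iso_def)
  ultimately show ?thesis by (simp add: view_color_def)
qed

lemma view_wf:
  assumes "v \<in> verts H"
  shows "\<forall>e\<in>edges (view H lab el r v). e \<subseteq> verts (view H lab el r v)"
    and "base (view H lab el r v) \<in> verts (view H lab el r v)"
  using assms by (auto simp: view_def gball_def induced_def ball_verts_def)

text \<open>A local rule receives an isomorphism class; \<open>f\<close> picks a view of
  \<open>H\<close> that represents it and evaluates there. As \<open>S\<close> ranges over all
  labelings, a single \<open>f\<close> serves every ID assignment.\<close>

lemma run_view_color:
  fixes H :: "'v ugraph" and el :: "'v set \<Rightarrow> 'e" and Out :: "(nat list \<Rightarrow> 'l) \<Rightarrow> nat option"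
  assumes "finite (verts H)"
  obtains f where "\<And>(lab :: 'v \<Rightarrow> 'l) v. v \<in> verts H \<Longrightarrow>
    run f r H lab el v = view_color \<Delta> r q Out (view H lab el r v)"
proof -
  define S :: "('v, 'l, 'e) lrgraph set" where "S = {view H lab el r v | lab v. v \<in> verts H}"
  define f where "f X = view_color \<Delta> r q Out (inv_into S iso_class X)" for X
  have "run f r H lab el v = view_color \<Delta> r q Out (view H lab el r v)"
    if v: "v \<in> verts H" for lab :: "'v \<Rightarrow> 'l" and v
  proof -
    let ?G = "view H lab el r v"
    define K where "K = inv_into S iso_class (iso_class ?G)"
    have "iso_class ?G \<in> iso_class ` S" using v by (auto simp: S_def)
    then have "K \<in> S" and eq: "iso_class ?G = iso_class K"
      unfolding K_def by (simp_all add: inv_into_into f_inv_into_f)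
    then obtain lab' v' where K: "K = view H lab' el r v'" "v' \<in> verts H"
      unfolding S_def by blast
    have K_wf: "\<forall>e\<in>edges K. e \<subseteq> verts K" "base K \<in> verts K"
      using view_wf[OF K(2)] K(1) by blast+
    have fin: "finite (verts ?G)" using assms by (simp add: view_def gball_def induced_def)
    have "lr_iso ?G K"
      by (rule iso_class_eq_iff[OF fin view_wf[OF v] K_wf, THEN iffD1, OF eq])
    then have "view_color \<Delta> r q Out ?G = view_color \<Delta> r q Out K"
      by (rule view_color_iso[OF _ view_wf[OF v] K_wf(1)])
    then show ?thesis by (simp add: run_def f_def K_def)
  qed
  then show thesis using that by blast
qed

lemma bob_wins_view:
  assumes H: "simple_graph H" and inj: "inj_on ident (verts H)" and v: "v \<in> verts H"
  shows "bob_wins \<Delta> (label_rel q ident el (edges (gball H v r))) Out i r 0 (\<lambda>_. ident v) \<longleftrightarrow>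
    bob_wins \<Delta> (label_rel q ident el (edges H)) Out i r 0 (\<lambda>_. ident v)"
proof -
  define B where "B m = ident ` {x \<in> verts H. (v, x) \<in> arcs H ^^ m}" for m
  have *: "\<exists>x y. a = ident x \<and> b = ident y \<and> {x, y} \<in> edges H \<and> el {x, y} = q j \<and>
      (v, x) \<in> arcs H ^^ m \<and> (v, y) \<in> arcs H ^^ Suc m \<and> x \<in> verts H \<and> y \<in> verts H"
    if a: "a \<in> B m" and ab: "(a, b) \<in> label_rel q ident el (edges H) j" for a b j m
  proof -
    obtain z where z: "a = ident z" "z \<in> verts H" "(v, z) \<in> arcs H ^^ m"
      using a by (auto simp: B_def)
    obtain x y where xy: "a = ident x" "b = ident y" "{x, y} \<in> edges H" "el {x, y} = q j"
      using ab by (auto simp: label_rel_def)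
    then have V: "x \<in> verts H" "y \<in> verts H" using H by (auto simp: simple_graph_def)
    \<comment> \<open>Injectivity excludes that the label \<open>a\<close> is shared with a vertex
      off the walk.\<close>
    then have "z = x" using z xy(1) inj by (simp add: inj_on_eq_iff)
    moreover have "(x, y) \<in> arcs H" using xy(3) by (simp add: arcs_def)
    ultimately show ?thesis using xy z V by auto
  qed
  have "bob_wins \<Delta> (label_rel q ident el (edges H)) Out i r 0 (\<lambda>_. ident v) \<longleftrightarrow>
    bob_wins \<Delta> (label_rel q ident el (edges (gball H v r))) Out i r 0 (\<lambda>_. ident v)"
  proof (rule bob_wins_local[of _ _ B])
    fix m a b j assume m: "m < 0 + r" "a \<in> B m"
    show "(a, b) \<in> label_rel q ident el (edges H) j \<longleftrightarrow>
      (a, b) \<in> label_rel q ident el (edges (gball H v r)) j"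
    proof
      assume "(a, b) \<in> label_rel q ident el (edges H) j"
      then obtain x y where xy: "a = ident x" "b = ident y" "{x, y} \<in> edges H" "el {x, y} = q j"
        "(v, x) \<in> arcs H ^^ m" "(v, y) \<in> arcs H ^^ Suc m" "x \<in> verts H" "y \<in> verts H"
        using * m(2) by blast
      have "m \<le> r" "Suc m \<le> r" using m(1) by auto
      then have "x \<in> ball_verts H v r" "y \<in> ball_verts H v r"
        unfolding ball_verts_def using xy(5-8) by blast+
      then show "(a, b) \<in> label_rel q ident el (edges (gball H v r)) j"
        using xy(1-4) by (auto simp: label_rel_def gball_def induced_def)
    qed (auto simp: label_rel_def gball_def induced_def)
    show "b \<in> B (Suc m)" if "(a, b) \<in> label_rel q ident el (edges H) j"
      using *[OF m(2) that] unfolding B_def by blast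
  qed (use v in \<open>auto simp: B_def\<close>)
  then show ?thesis by simp
qed

lemma view_color_range:
  assumes "\<Delta> \<ge> 1"
  shows "view_color \<Delta> r q Out G \<in> {1..\<Delta>}"
proof -
  have "(if \<exists>i. i \<in> {1..\<Delta>} \<and> P i then SOME i. i \<in> {1..\<Delta>} \<and> P i else 1) \<in> {1..\<Delta>}" for P
    using someI_ex[of "\<lambda>i. i \<in> {1..\<Delta>} \<and> P i"] assms by auto
  then show ?thesis unfolding view_color_def Let_def .
qed

lemma view_color_wins:
  assumes "\<exists>i\<in>{1..\<Delta>}. bob_wins \<Delta> (label_rel q (vlab G) (elab G) (edges G)) Out i r 0 (\<lambda>_. vlab G (base G))"
  shows "bob_wins \<Delta> (label_rel q (vlab G) (elab G) (edges G)) Out (view_color \<Delta> r q Out G) r 0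
    (\<lambda>_. vlab G (base G))"
  using someI_ex[of "\<lambda>i. i \<in> {1..\<Delta>} \<and>
      bob_wins \<Delta> (label_rel q (vlab G) (elab G) (edges G)) Out i r 0 (\<lambda>_. vlab G (base G))"] assms
  unfolding view_color_def Let_def by auto

text \<open>Injective IDs allow a homomorphism into labels to be pulled back to \<open>H\<close>. As
  \<open>\<Delta> \<ge> 1\<close> and \<open>n > 0\<close>, the root has an edge, which forces its
  label to be the ID of a vertex.\<close>

lemma tree_hom_lift:
  fixes q :: "nat \<Rightarrow> 'e"
  assumes H: "simple_graph H" and inj: "inj_on ident (verts H)" and \<Delta>: "\<Delta> \<ge> 1"
    and hom: "tree_hom \<Delta> (label_rel q ident el (edges H)) n \<psi>" "n > 0"
  obtains \<phi> where "graph_hom (tree_ball \<Delta> n) H \<phi>"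
    "\<forall>e\<in>edges (tree_ball \<Delta> n). el (\<phi> ` e) = (q \<circ> tree_color) e"
    "agree \<Delta> n (ident \<circ> \<phi>) \<psi>"
proof -
  have edge: "\<exists>x y. x \<in> verts H \<and> y \<in> verts H \<and> \<psi> u = ident x \<and> \<psi> (j # u) = ident y \<and>
      {x, y} \<in> edges H \<and> el {x, y} = q j"
    if ju: "j # u \<in> verts (reg_tree \<Delta>)" "length u < n" for j u
  proof -
    have "(\<psi> u, \<psi> (j # u)) \<in> label_rel q ident el (edges H) j"
      using hom(1) ju by (simp add: tree_hom_def)
    then obtain x y where xy: "\<psi> u = ident x" "\<psi> (j # u) = ident y" "{x, y} \<in> edges H"
      "el {x, y} = q j"
      by (auto simp: label_rel_def)
    moreover from xy(3) have "x \<in> verts H" "y \<in> verts H" using H by (auto simp: simple_graph_def)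
    ultimately show ?thesis by blast
  qed
  define \<phi> where "\<phi> = inv_into (verts H) ident \<circ> \<psi>"
  have img: "\<psi> w \<in> ident ` verts H" if "w \<in> verts (reg_tree \<Delta>)" "length w \<le> n" for w
  proof (cases w)
    case Nil
    then show ?thesis using edge[of 1 "[]"] \<Delta> hom(2) by auto
  next
    case (Cons j u)
    then show ?thesis using edge[of j u] that by auto
  qed
  have "agree \<Delta> n (ident \<circ> \<phi>) \<psi>"
    unfolding agree_def \<phi>_def using img by (simp add: f_inv_into_f)
  moreover have "\<phi> \<in> verts (tree_ball \<Delta> n) \<rightarrow> verts H"
    unfolding \<phi>_def using inv_into_into[OF img] by (auto simp: verts_tree_ball)
  moreover have "\<phi> ` e \<in> edges H \<and> el (\<phi> ` e) = (q \<circ> tree_color) e"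
    if "e \<in> edges (tree_ball \<Delta> n)" for e
  proof -
    have "e \<in> edges (reg_tree \<Delta>)" "e \<subseteq> verts (tree_ball \<Delta> n)"
      using that edges_tree_ball[of \<Delta> n] by auto
    moreover from this(1) obtain j u where e: "e = {u, j # u}" "j # u \<in> verts (reg_tree \<Delta>)"
      by (rule reg_tree_edgeE)
    ultimately have "length u < n" by (simp add: verts_tree_ball)
    then obtain x y where xy: "x \<in> verts H" "y \<in> verts H" "\<psi> u = ident x" "\<psi> (j # u) = ident y"
      "{x, y} \<in> edges H" "el {x, y} = q j"
      using edge[OF e(2)] by blast
    then have "\<phi> u = x" "\<phi> (j # u) = y" using inj by (simp_all add: \<phi>_def)
    then show ?thesis using xy e by simp
  qed
  ultimately show thesis using that unfolding graph_hom_def by blast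
qed

lemma tree_ball_edge_root: "i \<in> {1..\<Delta>} \<Longrightarrow> {[], [i]} \<in> edges (tree_ball \<Delta> (Suc r))"
  using edges_tree_ball[of \<Delta> "Suc r"] reg_tree_edgeI[of i "[]" \<Delta>] by (simp add: verts_tree_ball)

text \<open>With \<open>q = id\<close> the tree keeps its edge colors; with \<open>q\<close> constant they only organize the game and
  are invisible to the algorithm.\<close>

theorem local_rule_of_tree_algorithm:
  fixes H :: "'v ugraph" and q :: "nat \<Rightarrow> 'e" and el :: "'v set \<Rightarrow> 'e"
    and A :: "(nat, nat, 'e) lrgraph set \<rightharpoonup> nat"
  assumes H: "simple_graph H" "finite (verts H)" and \<Delta>: "\<Delta> \<ge> 1"
    and serial: "\<And>v u j. {v, u} \<in> edges H \<Longrightarrow> j \<in> {1..\<Delta>} \<Longrightarrow>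
      \<exists>w. {v, w} \<in> edges H \<and> el {v, w} = q j"
    and alg: "\<And>ident \<phi>. id_assignment H ident \<Longrightarrow> graph_hom (tree_ball \<Delta> (Suc r)) H \<phi> \<Longrightarrow>
      \<forall>e\<in>edges (tree_ball \<Delta> (Suc r)). el (\<phi> ` e) = (q \<circ> tree_color) e \<Longrightarrow>
      \<exists>c. (\<forall>v\<in>verts (tree_ball \<Delta> (Suc r)).
              run A r (tree_ball \<Delta> (Suc r)) (ident \<circ> \<phi>) (q \<circ> tree_color) v = Some (c v)) \<and>
          c \<in> verts (tree_ball \<Delta> (Suc r)) \<rightarrow> {1..\<Delta>} \<and>
          (\<forall>v w. {v, w} \<in> edges (tree_ball \<Delta> (Suc r)) \<longrightarrow>
             \<not> (c v = c w \<and> q (c w) = (q \<circ> tree_color) {v, w}))"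
  obtains f :: "(nat, nat, 'e) lrgraph set \<Rightarrow> nat" where
    "\<And>ident v. id_assignment H ident \<Longrightarrow> v \<in> verts H \<Longrightarrow> run f r H ident el v \<in> {1..\<Delta>}"
    "\<And>ident v w. id_assignment H ident \<Longrightarrow> {v, w} \<in> edges H \<Longrightarrow>
       run f r H ident el v = run f r H ident el w \<Longrightarrow> q (run f r H ident el w) \<noteq> el {v, w}"
proof -
  let ?T = "tree_ball \<Delta> (Suc r)"
  let ?tc = "q \<circ> tree_color"
  define Out where "Out lab = run A r ?T lab ?tc []" for lab
  have Out: "Out \<phi> = Out \<psi>" if "agree \<Delta> r \<phi> \<psi>" for \<phi> \<psi>
    unfolding Out_def by (rule run_root_agree[OF that])
  obtain f where f: "\<And>(lab :: 'v \<Rightarrow> nat) v. v \<in> verts H \<Longrightarrow>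
      run f r H lab el v = view_color \<Delta> r q Out (view H lab el r v)"
    using run_view_color[OF H(2)] by blast
  show thesis
  proof (rule that[of f])
    show "run f r H ident el v \<in> {1..\<Delta>}" if "v \<in> verts H" for ident v
      unfolding f[OF that] by (rule view_color_range[OF \<Delta>])
  next
    fix ident v w
    assume id: "id_assignment H ident" and vw: "{v, w} \<in> edges H"
      and same: "run f r H ident el v = run f r H ident el w"
    have inj: "inj_on ident (verts H)" using id by (simp add: id_assignment_def)
    let ?R = "label_rel q ident el (edges H)"
    \<comment> \<open>These are the labels of non-isolated vertices; from each of them every game
      color can be followed.\<close>
    define S where "S = {ident x | x. \<exists>y. {x, y} \<in> edges H}"
    have closed: "b \<in> S" if "(a, b) \<in> ?R j" for a b j
      using symD[OF sym_label_rel that] unfolding S_def label_rel_def by blast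
    have R_serial: "\<exists>b. (a, b) \<in> ?R j" if "a \<in> S" "j \<in> {1..\<Delta>}" for a j
    proof -
      obtain x y where "a = ident x" "{x, y} \<in> edges H" using \<open>a \<in> S\<close> by (auto simp: S_def)
      moreover from serial[OF this(2) \<open>j \<in> {1..\<Delta>}\<close>]
      obtain z where "{x, z} \<in> edges H" "el {x, z} = q j" by blast
      ultimately show ?thesis unfolding label_rel_def by blast
    qed
    \<comment> \<open>The guarantee of the algorithm, stated at the root: some color is output, and
      the ends of the root edge of color \<open>i\<close> do not both output \<open>i\<close>, since
      that edge carries the label \<open>q i\<close>.\<close>
    have color: "(\<exists>a\<in>{1..\<Delta>}. Out \<psi> = Some a) \<and>
        (\<forall>i\<in>{1..\<Delta>}. Out \<psi> = Some i \<longrightarrow> Out (\<psi> \<circ> rot i) \<noteq> Some i)"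
      if hom: "tree_hom \<Delta> ?R (Suc r) \<psi>" for \<psi>
    proof -
      obtain \<phi> where \<phi>: "graph_hom ?T H \<phi>" "\<forall>e\<in>edges ?T. el (\<phi> ` e) = ?tc e"
        "agree \<Delta> (Suc r) (ident \<circ> \<phi>) \<psi>"
        using tree_hom_lift[OF H(1) inj \<Delta> hom] by auto
      obtain c where c: "\<forall>v\<in>verts ?T. run A r ?T (ident \<circ> \<phi>) ?tc v = Some (c v)"
        "c \<in> verts ?T \<rightarrow> {1..\<Delta>}"
        "\<forall>v w. {v, w} \<in> edges ?T \<longrightarrow> \<not> (c v = c w \<and> q (c w) = ?tc {v, w})"
        using alg[OF id \<phi>(1,2)] by blast
      have root: "[] \<in> verts ?T" by (simp add: verts_tree_ball)
      have Some: "Out \<psi> = Some (c [])"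
        using c(1) root Out[OF agree_mono[OF \<phi>(3)]] by (simp add: Out_def)
      have "Out (\<psi> \<circ> rot i) = Some (c [i])" if i: "i \<in> {1..\<Delta>}" for i
      proof -
        have "agree \<Delta> r (ident \<circ> \<phi> \<circ> rot i) (\<psi> \<circ> rot i)"
          unfolding agree_def
        proof (intro ballI impI)
          fix w assume w: "w \<in> verts (reg_tree \<Delta>)" "length w \<le> r"
          show "(ident \<circ> \<phi> \<circ> rot i) w = (\<psi> \<circ> rot i) w"
            using \<phi>(3) rot_words[OF i w(1)] length_rot_le[of i w] w(2) by (simp add: agree_def)
        qed
        then have "Out (\<psi> \<circ> rot i) = run A r ?T (ident \<circ> \<phi>) ?tc [i]"
          using Out run_neighbor[OF i, of A r "ident \<circ> \<phi>" q] by (simp add: Out_def)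
        then show ?thesis using c(1) i by (simp add: verts_tree_ball)
      qed
      then have "Out (\<psi> \<circ> rot i) \<noteq> Some i" if "i \<in> {1..\<Delta>}" "Out \<psi> = Some i" for i
        using that Some c(3)[rule_format, OF tree_ball_edge_root[OF that(1)]]
          tree_color_edge[of "[]" i] by auto
      then show ?thesis using Some c(2) root by blast
    qed
    have win: "bob_wins \<Delta> ?R Out (run f r H ident el x) r 0 (\<lambda>_. ident x)"
      if xy: "{x, y} \<in> edges H" for x y
    proof -
      have x: "x \<in> verts H" using xy H(1) by (auto simp: simple_graph_def)
      let ?G = "view H ident el r x"
      have view: "vlab ?G = ident" "elab ?G = el" "edges ?G = edges (gball H x r)" "base ?G = x"
        by (simp_all add: view_def)
      have "\<exists>i\<in>{1..\<Delta>}. bob_wins \<Delta> ?R Out i r 0 (\<lambda>_. ident x)"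
      \<comment> \<open>Otherwise Alice's combined play, extended beyond depth \<open>r\<close>,
        would be a homomorphism on which the root gets no color.\<close>
      proof (rule ccontr)
        assume "\<not> ?thesis"
        then obtain \<psi> where \<psi>: "tree_hom \<Delta> ?R r \<psi>" "agree \<Delta> 0 (\<lambda>_. ident x) \<psi>"
          "\<forall>i\<in>{1..\<Delta>}. Out \<psi> \<noteq> Some i"
          using combine_alice[of \<Delta> ?R 0 "\<lambda>_. ident x" Out r] by (auto simp: tree_hom_def)
        have "\<psi> [] = ident x" using \<psi>(2) by (simp add: agree_def)
        then have "\<psi> [] \<in> S" using xy unfolding S_def by blast
        then obtain \<chi> where \<chi>: "\<And>k. tree_hom \<Delta> ?R k \<chi>"
          "\<And>w. w \<in> {w. length w \<le> r} \<Longrightarrow> \<chi> w = \<psi> w"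
          using extend_tree_hom[of "{w. length w \<le> r}" \<Delta> \<psi> ?R S] \<psi>(1) closed R_serial
          by (auto simp: tree_hom_def)
        have "Out \<chi> = Out \<psi>" by (rule Out) (simp add: agree_def \<chi>(2))
        then show False using color[OF \<chi>(1)] \<psi>(3) by auto
      qed
      \<comment> \<open>The color was chosen for the game on the ball of \<open>x\<close>;
        \<open>bob_wins_view\<close> transfers the win to \<open>H\<close>.\<close>
      then show ?thesis
        using view_color_wins[of \<Delta> q ?G Out r] unfolding view bob_wins_view[OF H(1) inj x] f[OF x]
        by blast
    qed
    define i where "i = run f r H ident el w"
    have w: "w \<in> verts H" using vw H(1) by (auto simp: simple_graph_def)
    have i: "i \<in> {1..\<Delta>}" unfolding i_def f[OF w] by (rule view_color_range[OF \<Delta>])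
    show "q (run f r H ident el w) \<noteq> el {v, w}"
    proof
      assume "q (run f r H ident el w) = el {v, w}"
      then have e: "(ident v, ident w) \<in> ?R i" using vw by (auto simp: label_rel_def i_def)
      \<comment> \<open>Before the first level only the root label counts, and
        \<open>\<theta> \<circ> rot i\<close> has root label \<open>ident w\<close>; so
        \<open>\<theta>\<close> opens the games at both ends.\<close>
      define \<theta> where "\<theta> u = (if u = [] then ident v else ident w)" for u :: "nat list"
      have "bob_wins \<Delta> ?R Out i r 0 \<theta>"
        by (rule bob_wins_agree[of _ _ _ _ "\<lambda>_. ident v"])
          (use Out win[OF vw] same in \<open>auto simp: agree_def \<theta>_def i_def\<close>)
      moreover have "bob_wins \<Delta> ?R Out i r 0 (\<theta> \<circ> rot i)"
        by (rule bob_wins_agree[of _ _ _ _ "\<lambda>_. ident w"])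
          (use Out win[of w v] vw in \<open>auto simp: agree_def \<theta>_def i_def insert_commute\<close>)
      ultimately obtain \<psi> where \<psi>: "tree_hom \<Delta> ?R r \<psi>" "tree_hom \<Delta> ?R r (\<psi> \<circ> rot i)"
        "\<psi> [] = ident v" "\<psi> [i] = ident w" "Out \<psi> = Some i" "Out (\<psi> \<circ> rot i) = Some i"
        using combine_bob[of \<Delta> 0 r Out i ?R \<theta>] Out i sym_label_rel[of q ident el "edges H" i] e
        by (auto simp: tree_hom_def \<theta>_def)
      \<comment> \<open>On reduced words this is the union of the balls of radius \<open>r\<close>
        about \<open>[]\<close> and \<open>[i]\<close>, on which the two outputs depend.\<close>
      let ?D = "{u. length u \<le> r \<or> u \<in> verts (reg_tree \<Delta>) \<and> length (rot i u) \<le> r}"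
      obtain \<chi> where \<chi>: "\<And>k. tree_hom \<Delta> ?R k \<chi>" "\<And>u. u \<in> ?D \<Longrightarrow> \<chi> u = \<psi> u"
      proof (rule extend_tree_hom[of ?D \<Delta> \<psi> ?R S])
        fix j u
        show "u \<in> ?D" if ju: "j # u \<in> ?D"
        proof (cases "u \<noteq> [] \<or> j \<noteq> i")
          case True
          then show ?thesis using ju words_ConsD by (auto simp: rot_Cons)
        qed auto
        show "(\<psi> u, \<psi> (j # u)) \<in> ?R j" if ju: "j # u \<in> verts (reg_tree \<Delta>)" "j # u \<in> ?D"
        proof (cases "length u < r")
          case True
          then show ?thesis using \<psi>(1) ju by (simp add: tree_hom_def)
        next
          case False
          then have len: "length (rot i (j # u)) \<le> r" using ju(2) by simp
          show ?thesis
          proof (cases "u \<noteq> [] \<or> j \<noteq> i")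
            case True
            \<comment> \<open>The edge lies in the ball about \<open>[i]\<close>, where
              \<open>\<psi> \<circ> rot i\<close> is the homomorphism to use.\<close>
            have u: "u \<in> verts (reg_tree \<Delta>)" using ju(1) words_ConsD by blast
            have eq: "rot i (j # u) = j # rot i u" by (rule rot_Cons[OF True])
            then have "((\<psi> \<circ> rot i) (rot i u), (\<psi> \<circ> rot i) (rot i (j # u))) \<in> ?R j"
              using \<psi>(2) rot_words[OF i ju(1)] len by (simp add: tree_hom_def)
            then show ?thesis by (simp only: comp_apply rot_rot[OF u] rot_rot[OF ju(1)])
          next
            \<comment> \<open>Here \<open>r = 0\<close>: the two balls are single vertices, and the
              edge joining them comes from the edge of \<open>H\<close> between \<open>v\<close> and
              \<open>w\<close>.\<close>
            case False
            then show ?thesis using \<psi>(3,4) e by auto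
          qed
        qed
      next
        show "\<psi> [] \<in> S" using \<psi>(3) vw unfolding S_def by blast
      qed (use closed R_serial in \<open>blast+\<close>)
      have "Out \<chi> = Some i"
        using \<psi>(5) Out[of \<chi> \<psi>] \<chi>(2) by (simp add: agree_def)
      moreover have "\<chi> (rot i u) = \<psi> (rot i u)" if "u \<in> verts (reg_tree \<Delta>)" "length u \<le> r" for u
        using \<chi>(2)[of "rot i u"] rot_words[OF i that(1)] rot_rot[OF that(1)] that(2) by simp
      then have "Out (\<chi> \<circ> rot i) = Some i"
        using \<psi>(6) Out[of "\<chi> \<circ> rot i" "\<psi> \<circ> rot i"] by (simp add: agree_def)
      ultimately show False using color[OF \<chi>(1)] i by blast
    qed
  qed
qed

section \<open>Specialization to unlabeled and to edge labeled graphs\<close>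

theorem mainTheorem5:
  fixes H :: "'v ugraph" and \<Delta> r :: nat
  assumes "simple_graph H" and "finite (verts H)" and "\<Delta> \<ge> 1"
  shows "((\<exists>A. glocal_algorithm \<Delta> r A \<and>
             glocal_colors \<Delta> r A (tree_ball \<Delta> (r + 1)) (Hom_ID (tree_ball \<Delta> (r + 1)) H)) \<longrightarrow>
           local_coloring \<Delta> r H) \<and>
         (\<forall>el. nice_labeling \<Delta> H el \<longrightarrow>
           (\<exists>A. glocal_algorithm \<Delta> r A \<and>
             glocal_edge_colors \<Delta> r A (tree_ball \<Delta> (r + 1)) tree_color
               (edge_Hom_ID (tree_ball \<Delta> (r + 1)) tree_color H el)) \<longrightarrow>
           local_edge_coloring \<Delta> r H el)"
proof (intro conjI allI impI; elim exE conjE)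
  fix A :: "(nat, nat, unit) lrgraph set \<rightharpoonup> nat"
  assume A: "glocal_colors \<Delta> r A (tree_ball \<Delta> (r + 1)) (Hom_ID (tree_ball \<Delta> (r + 1)) H)"
  \<comment> \<open>All edges carry the label \<open>()\<close>, so the color of an end always
    matches the edge and the edge labeled condition becomes properness.\<close>
  let ?q = "\<lambda>_ :: nat. ()"
  obtain f :: "(nat, nat, unit) lrgraph set \<Rightarrow> nat" where f:
    "\<And>ident v. id_assignment H ident \<Longrightarrow> v \<in> verts H \<Longrightarrow> run f r H ident (\<lambda>_. ()) v \<in> {1..\<Delta>}"
    "\<And>ident v w. id_assignment H ident \<Longrightarrow> {v, w} \<in> edges H \<Longrightarrow>
       run f r H ident (\<lambda>_. ()) v = run f r H ident (\<lambda>_. ()) w \<Longrightarrow> () \<noteq> ()"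
  proof (rule local_rule_of_tree_algorithm[OF assms, where q = ?q and el = "\<lambda>_. ()" and r = r and A = A])
    fix ident \<phi>
    assume "id_assignment H ident" "graph_hom (tree_ball \<Delta> (Suc r)) H \<phi>"
    then have "ident \<circ> \<phi> \<in> Hom_ID (tree_ball \<Delta> (r + 1)) H" unfolding Hom_ID_def by auto
    then obtain c where "\<forall>v\<in>verts (tree_ball \<Delta> (r + 1)).
        run A r (tree_ball \<Delta> (r + 1)) (ident \<circ> \<phi>) (\<lambda>_. ()) v = Some (c v)"
      "vertex_coloring \<Delta> (tree_ball \<Delta> (r + 1)) c"
      using A unfolding glocal_colors_def by blast
    then show "\<exists>c. (\<forall>v\<in>verts (tree_ball \<Delta> (Suc r)).
              run A r (tree_ball \<Delta> (Suc r)) (ident \<circ> \<phi>) (?q \<circ> tree_color) v = Some (c v)) \<and>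
          c \<in> verts (tree_ball \<Delta> (Suc r)) \<rightarrow> {1..\<Delta>} \<and>
          (\<forall>v w. {v, w} \<in> edges (tree_ball \<Delta> (Suc r)) \<longrightarrow>
             \<not> (c v = c w \<and> () = (?q \<circ> tree_color) {v, w}))"
      by (intro exI[of _ c]) (simp add: vertex_coloring_def comp_def)
  qed auto
  then show "local_coloring \<Delta> r H"
    unfolding local_coloring_def vertex_coloring_def by (intro exI[of _ f]) blast
next
  fix el and A :: "(nat, nat, nat) lrgraph set \<rightharpoonup> nat"
  assume nice: "nice_labeling \<Delta> H el"
    and A: "glocal_edge_colors \<Delta> r A (tree_ball \<Delta> (r + 1)) tree_color
      (edge_Hom_ID (tree_ball \<Delta> (r + 1)) tree_color H el)"
  obtain f :: "(nat, nat, nat) lrgraph set \<Rightarrow> nat" where f: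
    "\<And>ident v. id_assignment H ident \<Longrightarrow> v \<in> verts H \<Longrightarrow> run f r H ident el v \<in> {1..\<Delta>}"
    "\<And>ident v w. id_assignment H ident \<Longrightarrow> {v, w} \<in> edges H \<Longrightarrow>
       run f r H ident el v = run f r H ident el w \<Longrightarrow> id (run f r H ident el w) \<noteq> el {v, w}"
  proof (rule local_rule_of_tree_algorithm[OF assms, where q = id and el = el and r = r and A = A])
    \<comment> \<open>Niceness supplies an edge of every color at \<open>v\<close>, so the game
      never gets stuck.\<close>
    fix v u j assume vu: "{v, u} \<in> edges H" and j: "j \<in> {1..\<Delta>}"
    then have "v \<in> verts H" using assms(1) by (auto simp: simple_graph_def)
    then obtain e where e: "e \<in> edges H" "v \<in> e" "el e = j"
      using nice j unfolding nice_labeling_def by blast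
    then have "card e = 2" using assms(1) by (simp add: simple_graph_def)
    then obtain w where "e = {v, w}" using e(2) by (auto simp: card_2_iff)
    then show "\<exists>w. {v, w} \<in> edges H \<and> el {v, w} = id j" using e by auto
  next
    fix ident \<phi>
    assume "id_assignment H ident" "graph_hom (tree_ball \<Delta> (Suc r)) H \<phi>"
      "\<forall>e\<in>edges (tree_ball \<Delta> (Suc r)). el (\<phi> ` e) = (id \<circ> tree_color) e"
    then have "ident \<circ> \<phi> \<in> edge_Hom_ID (tree_ball \<Delta> (r + 1)) tree_color H el"
      unfolding edge_Hom_ID_def edge_graph_hom_def by auto
    then obtain c where "\<forall>v\<in>verts (tree_ball \<Delta> (r + 1)).
        run A r (tree_ball \<Delta> (r + 1)) (ident \<circ> \<phi>) tree_color v = Some (c v)"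
      "edge_labeled_coloring \<Delta> (tree_ball \<Delta> (r + 1)) tree_color c"
      using A unfolding glocal_edge_colors_def by blast
    then show "\<exists>c. (\<forall>v\<in>verts (tree_ball \<Delta> (Suc r)).
              run A r (tree_ball \<Delta> (Suc r)) (ident \<circ> \<phi>) (id \<circ> tree_color) v = Some (c v)) \<and>
          c \<in> verts (tree_ball \<Delta> (Suc r)) \<rightarrow> {1..\<Delta>} \<and>
          (\<forall>v w. {v, w} \<in> edges (tree_ball \<Delta> (Suc r)) \<longrightarrow>
             \<not> (c v = c w \<and> id (c w) = (id \<circ> tree_color) {v, w}))"
      by (intro exI[of _ c]) (simp add: edge_labeled_coloring_def)
  qed auto
  then show "local_edge_coloring \<Delta> r H el"
    unfolding local_edge_coloring_def edge_labeled_coloring_def by (intro exI[of _ f]) auto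
qed

end
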